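(* Let $(z_k)_{k\in\mathbb{N}}$ be a sequence of pairwise distinct complex numbers with $|z_k|\to\infty$, let $f$ be a Weierstrass map whose simple zeros are the points $z_1,z_2,\ldots$, let $n\ge2$, and let $S(f)=\{(z,w)\in\mathbb{C}^2: w^n=f(z)\}$ be the infinite superelliptic curve with its tame translation structure. Let $\mathbb{C}^{\star}=\mathbb{C}\setminus\{z_k:k\in\mathbb{N}\}$, let $\tilde p:\tilde S\to\mathbb{C}^{\star}$ be a (topological, unramified) universal covering map, and endow $\tilde S$ with the translation structure obtained by lifting that of $\mathbb{C}^{\star}$ via $\tilde p$. Then: (1) $\Gamma(S(f))$ is a subgroup of $\Gamma(\tilde S)$; (2) $\Gamma(\mathbb{C}^{\star})=\Gamma(\tilde S)$.
   Context: Weierstrass map: for a sequence $(z_k)_{k\in\mathbb{N}}$ of distinct complex numbers with $|z_k|\to\infty$, a function $f(z)=h(z)z^{m}\prod_{k\ge 1,\,z_k\ne 0}\left(1-\frac{z}{z_k}\right)E_k(z)$, where $h$ is a zero-free entire function, $m=1$ if some $z_k=0$ and $m=0$ otherwise, and $E_k(z)=\exp\left[\sum_{s=1}^{d(k)}\frac1s\left(\frac{z}{z_k}\right)^s\right]$ with suitably large non-negative integers $d(k)$ (so that the product converges). Its zeros are simple and are exactly the points $z_k$. Translation structures: $\mathbb{C}^{\star}$ is a translation surface as an open subset of $\mathbb{C}$. Let $p_{\mathbf z}:S(f)\to\mathbb{C}$, $(z,w)\mapsto z$. The restriction $p_{\mathbf z}: S(f)\setminus\{(z_k,0):k\in\mathbb{N}\}\to\mathbb{C}^{\star}$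 is an unramified covering of degree $n$, by which the translation structure of $\mathbb{C}^{\star}$ is pulled back; the cone points of $S(f)$ are exactly the points $(z_k,0)$. Veech group: identify $\mathbb{C}$ with $\mathbb{R}^2$. An affine diffeomorphism $T:S\to S$ of a translation surface is a homeomorphism sending cone points to cone points which in the local coordinates of the translation atlas is a real-affine map $z\mapsto A\cdot z+t$ with $A\in{\rm GL}(2,\mathbb{R})$, $t\in\mathbb{C}$. ${\rm Aff}_+(S)$ is the group of orientation preserving affine diffeomorphisms of $S$. The differential of $T\in{\rm Aff}_+(S)$ is a constant matrix $D(T)\in{\rm GL}_+(2,\mathbb{R})$ (the group of real $2\times2$ matrices with positive determinant), and $D:{\rm Aff}_+(S)\to{\rm GL}_+(2,\mathbb{R})$ is a group homomorphism whose image $\Gamma(S)$ is the Veech group of $S$. The group ${\rm Aff}_+(\mathbb{C}^{\star})$ consists of the orientation preserving affine diffeomorphisms of $\mathbb{C}$ permuting the points of $(z_k)_{k\in\mathbb{N}}$. *)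

theory Defs
  imports
    "HOL-Complex_Analysis.Complex_Analysis"
    "HOL-Algebra.Group"
begin

section \<open>The group of orientation preserving linear maps of the plane\<close>

definition GL2_plus :: "(real^2^2) monoid"
  where "GL2_plus = \<lparr>carrier = {A. det A > 0}, mult = (**), one = mat 1\<rparr>"

text \<open>The matrix action on the plane, with \<open>x + \<i>y\<close> identified with the column vector \<open>(x, y)\<close>.\<close>

definition mat_act :: "real^2^2 \<Rightarrow> complex \<Rightarrow> complex"
  where "mat_act A x =
    Complex (A $ 1 $ 1 * Re x + A $ 1 $ 2 * Im x) (A $ 2 $ 1 * Re x + A $ 2 $ 2 * Im x)"


section \<open>Translation structures and Veech groups\<close>

text \<open>
  A translation surface is recorded as a space, its set of cone points, and an atlas of
  complex-valued charts \<open>(U, \<phi>)\<close> covering the complement of the cone points; \<open>\<phi>\<close> is only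
  meaningful on \<open>U\<close>.  The atlas need not be maximal.
\<close>

record 'a translation_surface =
  space_of :: "'a topology"
  cone_points :: "'a set"
  charts :: "('a set \<times> ('a \<Rightarrow> complex)) set"

definition regular_points :: "'a translation_surface \<Rightarrow> 'a set"
  where "regular_points S = topspace (space_of S) - cone_points S"

text \<open>
  In all charts around \<open>x\<close> and around \<open>T x\<close>, the map \<open>T\<close> has, near \<open>x\<close>, the form
  \<open>u \<mapsto> A u + t\<close>.
\<close>

definition affine_at :: "'a translation_surface \<Rightarrow> ('a \<Rightarrow> 'a) \<Rightarrow> real^2^2 \<Rightarrow> 'a \<Rightarrow> bool"
  where "affine_at S T A x \<longleftrightarrow>
    (\<forall>(U, \<phi>) \<in> charts S. \<forall>(V, \<psi>) \<in> charts S. x \<in> U \<longrightarrow> T x \<in> V \<longrightarrow>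
      (\<exists>W t. openin (space_of S) W \<and> x \<in> W \<and> W \<subseteq> U \<and> T ` W \<subseteq> V \<and>
        (\<forall>y\<in>W. \<psi> (T y) = mat_act A (\<phi> y) + t)))"

text \<open>
  Maps are made \<^const>\<open>extensional\<close> so that they are determined by their values on the surface.
\<close>

definition affine_diffeos :: "'a translation_surface \<Rightarrow> ('a \<Rightarrow> 'a) set"
  where "affine_diffeos S =
    {T \<in> extensional (topspace (space_of S)).
      homeomorphic_map (space_of S) (space_of S) T \<and>
      T ` cone_points S = cone_points S \<and>
      (\<forall>x \<in> regular_points S. \<exists>A. invertible A \<and> affine_at S T A x)}"

definition Aff_plus :: "'a translation_surface \<Rightarrow> ('a \<Rightarrow> 'a) set"
  where "Aff_plus S =
    {T \<in> affine_diffeos S. \<forall>x \<in> regular_points S. \<forall>A. affine_at S T A x \<longrightarrow> det A > 0}"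

text \<open>
  The linear part is unique at each regular point, and it is constant when the set of regular
  points is connected (and nonempty); this is the situation in which the following is meaningful.
\<close>

definition differential :: "'a translation_surface \<Rightarrow> ('a \<Rightarrow> 'a) \<Rightarrow> real^2^2"
  where "differential S T = (THE A. \<forall>x \<in> regular_points S. affine_at S T A x)"

definition veech_group :: "'a translation_surface \<Rightarrow> (real^2^2) monoid"
  where "veech_group S = GL2_plus\<lparr>carrier := differential S ` Aff_plus S\<rparr>"

text \<open>
  The pull-back of a translation structure without cone points along a covering
  \<open>q\<close> from \<open>topspace X - \<Sigma>\<close> onto the space of \<open>B\<close>; the points of \<open>\<Sigma>\<close> become the cone points.
\<close>

definition pullback_surface ::
  "'a topology \<Rightarrow> 'a set \<Rightarrow> ('a \<Rightarrow> 'b) \<Rightarrow> 'b translation_surface \<Rightarrow> 'a translation_surface"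
  where "pullback_surface X \<Sigma> q B =
    \<lparr>space_of = X, cone_points = \<Sigma>,
     charts = {(U, \<psi> \<circ> q) | U V \<psi>.
       openin X U \<and> U \<inter> \<Sigma> = {} \<and> (V, \<psi>) \<in> charts B \<and> q ` U \<subseteq> V \<and>
       openin (space_of B) (q ` U) \<and>
       homeomorphic_map (subtopology X U) (subtopology (space_of B) (q ` U)) q}\<rparr>"


section \<open>Weierstrass maps\<close>

text \<open>
  Compact convergence of an infinite product: on each compact set some tail of the product
  converges uniformly to a function without zeros there.
\<close>

definition compactly_convergent_prod :: "(nat \<Rightarrow> complex \<Rightarrow> complex) \<Rightarrow> bool"
  where "compactly_convergent_prod F \<longleftrightarrow>
    (\<forall>K. compact K \<longrightarrow>
      (\<exists>M g. uniform_limit K (\<lambda>N x. \<Prod>k=M..<N. F k x) g sequentially \<and> (\<forall>x\<in>K. g x \<noteq> 0)))"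

text \<open>
  \<open>weierstrass_factor (d k) (x / z k)\<close> is the product of \<open>1 - x / z k\<close> and the exponential
  convergence factor \<open>E\<^sub>k(x)\<close>.  A zero at the origin is accounted for by the power of \<open>x\<close>.
\<close>

definition weierstrass_term :: "(nat \<Rightarrow> complex) \<Rightarrow> (nat \<Rightarrow> nat) \<Rightarrow> nat \<Rightarrow> complex \<Rightarrow> complex"
  where "weierstrass_term z d k x = (if z k = 0 then 1 else weierstrass_factor (d k) (x / z k))"

definition weierstrass_map :: "(nat \<Rightarrow> complex) \<Rightarrow> (complex \<Rightarrow> complex) \<Rightarrow> bool"
  where "weierstrass_map z f \<longleftrightarrow>
    (\<exists>h d. h holomorphic_on UNIV \<and> (\<forall>x. h x \<noteq> 0) \<and>
      compactly_convergent_prod (weierstrass_term z d) \<and>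
      (\<forall>x. f x = h x * x ^ (if 0 \<in> range z then 1 else 0) * (\<Prod>k. weierstrass_term z d k x)))"


section \<open>The surfaces\<close>

definition punctured_plane :: "(nat \<Rightarrow> complex) \<Rightarrow> complex translation_surface"
  where "punctured_plane z =
    \<lparr>space_of = top_of_set (- range z), cone_points = {}, charts = {(- range z, \<lambda>x. x)}\<rparr>"

definition superelliptic_curve ::
  "nat \<Rightarrow> (nat \<Rightarrow> complex) \<Rightarrow> (complex \<Rightarrow> complex) \<Rightarrow> (complex \<times> complex) translation_surface"
  where "superelliptic_curve n z f =
    pullback_surface (top_of_set {(x, w). w ^ n = f x}) (range (\<lambda>k. (z k, 0))) fst
      (punctured_plane z)"

text \<open>The structure lifted to a covering space \<open>C\<close> of the punctured plane; no cone points arise.\<close>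

definition lifted_surface ::
  "'a::topological_space set \<Rightarrow> ('a \<Rightarrow> complex) \<Rightarrow> (nat \<Rightarrow> complex) \<Rightarrow> 'a translation_surface"
  where "lifted_surface C p z = pullback_surface (top_of_set C) {} p (punctured_plane z)"

section \<open>Affine diffeomorphisms of the punctured plane\<close>

text \<open>
  With the translation structure of an open subset of the plane, the orientation preserving affine
  diffeomorphisms of the punctured plane are the restrictions of the orientation preserving
  affine bijections of the plane that permute the punctures
  (\<open>Aff_plus_punctured_plane\<close> below).
\<close>

lemma mat_act_add: "mat_act A (x + y) = mat_act A x + mat_act A y"
  by (simp add: mat_act_def complex_eq_iff algebra_simps)

lemma mat_act_diff: "mat_act A (x - y) = mat_act A x - mat_act A y"
  by (simp add: mat_act_def complex_eq_iff algebra_simps)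

lemma mat_act_mult: "mat_act (A ** B) x = mat_act A (mat_act B x)"
  by (simp add: mat_act_def complex_eq_iff matrix_matrix_mult_def sum_2 algebra_simps)

lemma mat_act_one [simp]: "mat_act (mat 1) x = x"
  by (simp add: mat_act_def complex_eq_iff mat_def)

lemma mat_act_scaleR: "mat_act A (r *\<^sub>R x) = r *\<^sub>R mat_act A x"
  by (simp add: mat_act_def complex_eq_iff algebra_simps)

lemma mat_act_eqI:
  assumes "mat_act A 1 = mat_act B 1" "mat_act A \<i> = mat_act B \<i>"
  shows "A = B"
  using assms by (simp add: mat_act_def complex_eq_iff vec_eq_iff forall_2)

lemma continuous_on_mat_act [continuous_intros]:
  "continuous_on S g \<Longrightarrow> continuous_on S (\<lambda>x. mat_act A (g x))"
  unfolding mat_act_def Complex_eq by (intro continuous_intros)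

lemma affine_unique:
  assumes "open W" "w \<in> W" and eq: "\<And>y. y \<in> W \<Longrightarrow> mat_act A y + s = mat_act B y + t"
  shows "A = B \<and> s = t"
proof -
  obtain e where e: "e > 0" "ball w e \<subseteq> W" using assms by (meson openE)
  have lin: "mat_act A v = mat_act B v" if "norm v = 1" for v
  proof -
    have "w + (e/2) *\<^sub>R v \<in> W" using e that by (intro subsetD[OF e(2)]) (simp add: dist_norm)
    from eq[OF this]
    have "(mat_act A w + s) + (e/2) *\<^sub>R mat_act A v = (mat_act B w + t) + (e/2) *\<^sub>R mat_act B v"
      by (simp add: mat_act_add mat_act_scaleR add_ac)
    hence "(e/2) *\<^sub>R mat_act A v = (e/2) *\<^sub>R mat_act B v"
      unfolding eq[OF assms(2)] by simp
    thus ?thesis using e by simp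
  qed
  have "A = B" by (rule mat_act_eqI; rule lin) simp_all
  thus ?thesis using eq[OF assms(2)] by simp
qed

lemma closed_range_if_tendsto_infinity:
  fixes z :: "nat \<Rightarrow> complex"
  assumes "filterlim (\<lambda>k. norm (z k)) at_top sequentially"
  shows "closed (range z)"
proof -
  have "finite (range z \<inter> cball 0 r)" for r
  proof -
    have "eventually (\<lambda>k. norm (z k) > r) sequentially"
      using assms by (simp add: filterlim_at_top_dense)
    then obtain N where N: "\<And>k. k \<ge> N \<Longrightarrow> norm (z k) > r" by (auto simp: eventually_sequentially)
    have "range z \<inter> cball 0 r \<subseteq> z ` {..<N}"
      using N by (force simp: not_le[symmetric])
    thus ?thesis by (rule finite_subset) simp
  qed
  moreover have "range z \<inter> ball x 1 \<subseteq> range z \<inter> cball 0 (norm x + 1)" for x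
  proof
    fix y assume y: "y \<in> range z \<inter> ball x 1"
    have "norm y \<le> norm (y - x) + norm x" using norm_triangle_ineq[of "y - x" x] by simp
    thus "y \<in> range z \<inter> cball 0 (norm x + 1)" using y by (simp add: dist_norm norm_minus_commute)
  qed
  ultimately have "\<not> x islimpt range z" for x
    by (metis finite_subset islimpt_eq_infinite_ball zero_less_one)
  thus ?thesis by (simp add: closed_limpt)
qed

lemma affine_at_punctured_plane:
  assumes "open (- range z)" "x \<notin> range z" "T x \<notin> range z"
  shows "affine_at (punctured_plane z) T A x \<longleftrightarrow>
    (\<exists>W t. open W \<and> x \<in> W \<and> W \<subseteq> - range z \<and> T ` W \<subseteq> - range z \<and> (\<forall>y\<in>W. T y = mat_act A y + t))"
  using assms by (auto simp: affine_at_def punctured_plane_def openin_open_eq)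

lemma affine_bij:
  assumes "det A > 0"
  shows "\<exists>B. (\<forall>x. mat_act B (mat_act A x) = x) \<and> (\<forall>x. mat_act A (mat_act B x) = x)"
proof -
  have "invertible A" using assms invertible_det_nz[of A] by simp
  then obtain B where "A ** B = mat 1" "B ** A = mat 1" unfolding invertible_def by blast
  thus ?thesis by (metis mat_act_mult mat_act_one)
qed

lemma Aff_plus_punctured_plane:
  assumes lim: "filterlim (\<lambda>k. norm (z k)) at_top sequentially"
  shows "Aff_plus (punctured_plane z) =
    {restrict (\<lambda>x. mat_act A x + t) (- range z) | A t.
      det A > 0 \<and> (\<lambda>x. mat_act A x + t) ` range z = range z}"
proof -
  let ?C = "- range z" and ?S = "punctured_plane z"
  have op: "open ?C" using closed_range_if_tendsto_infinity[OF lim] by blast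
  have con: "connected ?C"
    by (intro path_connected_imp_connected path_connected_complement_countable) auto
  have ne: "?C \<noteq> {}"
    by (metis Compl_empty_eq countable_image countableI_type double_complement uncountable_UNIV_complex)
  have reg: "regular_points ?S = ?C" "space_of ?S = top_of_set ?C" "cone_points ?S = {}"
    by (auto simp: regular_points_def punctured_plane_def)
  show ?thesis
  proof (intro equalityI subsetI)
    fix T assume T: "T \<in> Aff_plus ?S"
    hence ext: "T \<in> extensional ?C" and hom: "homeomorphic_map (top_of_set ?C) (top_of_set ?C) T"
      and loc: "\<And>x. x \<in> ?C \<Longrightarrow> \<exists>A. affine_at ?S T A x"
      and pos: "\<And>x A. x \<in> ?C \<Longrightarrow> affine_at ?S T A x \<Longrightarrow> det A > 0"
      unfolding Aff_plus_def affine_diffeos_def reg by auto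
    have im: "T ` ?C = ?C" using homeomorphic_imp_surjective_map[OF hom] by simp
    have "\<exists>W A t. open W \<and> x \<in> W \<and> W \<subseteq> ?C \<and> (\<forall>y\<in>W. T y = mat_act A y + t)" if x: "x \<in> ?C" for x
    proof -
      obtain A where "affine_at ?S T A x" using loc[OF x] by blast
      moreover have "T x \<in> ?C" using x im by blast
      ultimately show ?thesis using x affine_at_punctured_plane[OF op, of x T A] by auto
    qed
    then obtain W A t where W: "\<And>x. x \<in> ?C \<Longrightarrow> open (W x)" "\<And>x. x \<in> ?C \<Longrightarrow> x \<in> W x"
      "\<And>x. x \<in> ?C \<Longrightarrow> W x \<subseteq> ?C"
      "\<And>x y. x \<in> ?C \<Longrightarrow> y \<in> W x \<Longrightarrow> T y = mat_act (A x) y + t x"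
      by metis
    have "(\<lambda>x. (A x, t x)) constant_on ?C"
    proof (rule locally_constant_imp_constant[OF con])
      fix a assume a: "a \<in> ?C"
      show "\<exists>U. openin (top_of_set ?C) U \<and> a \<in> U \<and> (\<forall>x\<in>U. (A x, t x) = (A a, t a))"
      proof (intro exI[of _ "W a"] conjI ballI)
        show "openin (top_of_set ?C) (W a)" using W[OF a] by (simp add: openin_open_eq[OF op])
        show "a \<in> W a" using W[OF a] by simp
        fix b assume b: "b \<in> W a"
        hence b': "b \<in> ?C" using W(3)[OF a] by blast
        have "A b = A a \<and> t b = t a"
        proof (rule affine_unique)
          show "open (W a \<inter> W b)" "b \<in> W a \<inter> W b" using W a b b' by auto
          fix y assume "y \<in> W a \<inter> W b"
          thus "mat_act (A b) y + t b = mat_act (A a) y + t a"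
            using W(4)[OF a, of y] W(4)[OF b', of y] by simp
        qed
        thus "(A b, t b) = (A a, t a)" by simp
      qed
    qed
    then obtain B s where "\<And>x. x \<in> ?C \<Longrightarrow> A x = B \<and> t x = s"
      unfolding constant_on_def by (metis prod.inject surj_pair)
    hence glob: "T x = mat_act B x + s" if "x \<in> ?C" for x using W that by metis
    have "affine_at ?S T B x" if "x \<in> ?C" for x
    proof -
      have "T x \<in> ?C" using that im by blast
      moreover have "open ?C \<and> x \<in> ?C \<and> ?C \<subseteq> ?C \<and> T ` ?C \<subseteq> ?C \<and> (\<forall>y\<in>?C. T y = mat_act B y + s)"
        using op that im glob by blast
      ultimately show ?thesis
        using affine_at_punctured_plane[OF op, of x T B] that by blast
    qed
    hence det: "det B > 0" using ne pos by blast
    let ?g = "\<lambda>x. mat_act B x + s"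
    obtain D where D: "\<And>x. mat_act D (mat_act B x) = x" "\<And>x. mat_act B (mat_act D x) = x"
      using affine_bij[OF det] by blast
    have "bij ?g" by (rule o_bij[of "\<lambda>y. mat_act D (y - s)"]) (auto simp: fun_eq_iff D)
    moreover have "?g ` ?C = ?C" using im glob by (metis (no_types, lifting) image_cong)
    ultimately have "?g ` range z = range z" using bij_image_Compl_eq[of ?g ?C] by simp
    moreover have "T = restrict ?g ?C"
      using ext glob by (intro extensionalityI[of _ ?C]) auto
    ultimately show "T \<in> {restrict (\<lambda>x. mat_act A x + t) ?C | A t. det A > 0 \<and> (\<lambda>x. mat_act A x + t) ` range z = range z}"
      using det by blast
  next
    fix T assume "T \<in> {restrict (\<lambda>x. mat_act A x + t) ?C | A t. det A > 0 \<and> (\<lambda>x. mat_act A x + t) ` range z = range z}"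
    then obtain A t where T: "T = restrict (\<lambda>x. mat_act A x + t) ?C" and det: "det A > 0"
      and rz: "(\<lambda>x. mat_act A x + t) ` range z = range z" by blast
    let ?g = "\<lambda>x. mat_act A x + t"
    obtain B where B: "\<And>x. mat_act B (mat_act A x) = x" "\<And>x. mat_act A (mat_act B x) = x"
      using affine_bij[OF det] by blast
    let ?h = "\<lambda>y. mat_act B (y - t)"
    have gh: "?h (?g x) = x" "?g (?h x) = x" for x by (simp_all add: B)
    have "bij ?g" by (rule o_bij[of ?h]) (auto simp: fun_eq_iff B)
    hence gC: "?g ` ?C = ?C" using rz bij_image_Compl_eq[of ?g "range z"] by simp
    hence hC: "?h ` ?C = ?C" using gh image_image[of ?h ?g ?C] by simp
    have TC: "T ` ?C = ?C" using gC T by simp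
    have "homeomorphism ?C ?C T ?h"
      unfolding homeomorphism_def
    proof (intro conjI ballI)
      show "continuous_on ?C T" 
      proof (rule continuous_on_eq)
        show "continuous_on ?C ?g" by (intro continuous_intros)
      qed (simp add: T)
      show "continuous_on ?C ?h" by (intro continuous_intros)
      show "T ` ?C = ?C" "?h ` ?C = ?C" by (fact TC hC)+
      show "?h (T x) = x" if "x \<in> ?C" for x using that gh T by simp
      show "T (?h x) = x" if "x \<in> ?C" for x
      proof -
        have "?h x \<in> ?C" using that hC by blast
        thus ?thesis using gh T by simp
      qed
    qed
    hence hom: "homeomorphic_map (top_of_set ?C) (top_of_set ?C) T"
      unfolding homeomorphic_map_maps homeomorphic_maps_def homeomorphism_def
      by (intro exI[of _ ?h]) (auto simp: continuous_map_subtopology_eu)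
    have aff: "affine_at ?S T M x \<longleftrightarrow> M = A" if x: "x \<in> ?C" for x M
    proof -
      have "T x \<in> ?C" using x TC by blast
      hence "affine_at ?S T M x \<longleftrightarrow> (\<exists>W t. open W \<and> x \<in> W \<and> W \<subseteq> - range z \<and> T ` W \<subseteq> - range z \<and> (\<forall>y\<in>W. T y = mat_act M y + t))"
        (is "_ \<longleftrightarrow> ?R") using affine_at_punctured_plane[OF op] x by auto
      also have "\<dots> \<longleftrightarrow> M = A"
      proof
        assume ?R
        then obtain W s where W: "open W" "x \<in> W" "W \<subseteq> ?C" "\<And>y. y\<in>W \<Longrightarrow> T y = mat_act M y + s" by auto
        have "M = A \<and> s = t"
          using W by (intro affine_unique[of W x]) (auto simp: T subset_iff)
        thus "M = A" ..
      next
        assume M: "M = A"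
        show ?R using op x TC M by (intro exI[of _ ?C] exI[of _ t]) (auto simp: T)
      qed
      finally show ?thesis .
    qed
    have "invertible A" using det invertible_det_nz[of A] by simp
    thus "T \<in> Aff_plus ?S"
      unfolding Aff_plus_def affine_diffeos_def reg using T hom aff det by auto
  qed
qed

end

theory Submission
  imports Defs
begin

text \<open>
  All surfaces here come with a local homeomorphism \<open>q\<close> onto the punctured plane whose restrictions
  are the charts.  On a connected surface an affine diffeomorphism \<open>T\<close> therefore satisfies
  \<open>q \<circ> T = A q + t\<close> globally, so \<open>x \<mapsto> A x + t\<close> maps the punctured plane onto itself: every Veech
  group in sight is contained in the one of the punctured plane.  Conversely an affine bijection of
  the punctured plane lifts to the universal cover.  The regular part of the superelliptic curve is
  connected because \<open>f\<close> has a simple zero.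
\<close>

section \<open>Surfaces with a developing map\<close>

text \<open>All Veech groups carry the matrix product, so both claims reduce to comparing carriers
  with one set: the matrices of positive determinant for which some
  \<open>x \<mapsto> A x + t\<close> preserves the punctured plane. Connectedness of the regular
  part is essential, since \<open>differential\<close> is a definite description over all regular
  points and different components could have different linear parts. For the curve, the geometric
  reason is that one turn around a simple zero multiplies \<open>w\<close> by a primitive n-th root
  of unity and so joins all sheets. Instead of monodromy the proof counts: a clopen part with
  \<open>d\<close> points in each fibre yields a continuous n-th root of the d-th power of
  \<open>f\<close>, which winds \<open>d\<close> times around the zero, so \<open>n\<close> divides
  \<open>d\<close> and the part is empty or everything. For the universal cover, the total space
  lies in an arbitrary topological space, so lifts are built from evenly covered sets alone.\<close>

text \<open>The equation \<open>\<phi> = q\<close> can be asked of total functions because the only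
  chart of the punctured plane is the identity: every chart of a pull-back carries \<open>q\<close>
  itself and only the domain varies. Openness of \<open>q\<close> is asked inside chart domains,
  where uniqueness of the linear part uses it.\<close>

locale developed_surface =
  fixes S :: "'a::topological_space translation_surface" and Y :: "'a set"
    and q :: "'a \<Rightarrow> complex" and D :: "complex set"
  assumes space: "space_of S = top_of_set Y" and cone: "cone_points S \<subseteq> Y"
    and chart: "(U, \<phi>) \<in> charts S \<Longrightarrow> \<phi> = q \<and> openin (top_of_set Y) U \<and> U \<subseteq> regular_points S"
    and open_image: "(U, \<phi>) \<in> charts S \<Longrightarrow> openin (top_of_set Y) W \<Longrightarrow> W \<subseteq> U \<Longrightarrow> open (q ` W)"
    and cover: "x \<in> regular_points S \<Longrightarrow> \<exists>U. (U, q) \<in> charts S \<and> x \<in> U"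
    and connected_regular: "connected (regular_points S)"
    and regular_nonempty: "regular_points S \<noteq> {}"
    and onto: "q ` regular_points S = D"
begin

abbreviation "R \<equiv> regular_points S"

abbreviation "affine_wrt T A t \<equiv> \<forall>x\<in>R. q (T x) = mat_act A (q x) + t"

lemma regular_eq: "R = Y - cone_points S" by (simp add: regular_points_def space)

text \<open>Only the values of \<open>q\<close> on \<open>W\<close> enter, and they fill an open
  subset of the plane.\<close>

lemma local_affine_unique:
  assumes "x \<in> W" "openin (top_of_set Y) W" "(U, \<phi>) \<in> charts S" "W \<subseteq> U"
    and "\<And>y. y \<in> W \<Longrightarrow> mat_act A (q y) + s = mat_act B (q y) + t"
  shows "A = B \<and> s = t"
proof (rule affine_unique)
  show "open (q ` W)" by (rule open_image[OF assms(3,2,4)])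
  show "q x \<in> q ` W" using assms(1) by blast
  show "mat_act A y + s = mat_act B y + t" if "y \<in> q ` W" for y
    using that assms(5) by blast
qed

text \<open>\<open>affine_at\<close> quantifies over all pairs of charts and is void where there are
  none. \<open>cover\<close>, applied at \<open>x\<close> and at \<open>T x\<close>, supplies a
  pair, and since both charts are \<open>q\<close> the local formula no longer mentions
  them.\<close>

lemma affine_atD:
  assumes "affine_at S T A x" "x \<in> R" "T x \<in> R"
  obtains U W t where "(U, q) \<in> charts S" "openin (top_of_set Y) W" "x \<in> W" "W \<subseteq> U"
    "\<And>y. y \<in> W \<Longrightarrow> q (T y) = mat_act A (q y) + t"
proof -
  obtain U V where U: "(U, q) \<in> charts S" "x \<in> U" and V: "(V, q) \<in> charts S" "T x \<in> V"
    using cover assms by blast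
  have "\<exists>W t. openin (space_of S) W \<and> x \<in> W \<and> W \<subseteq> U \<and> T ` W \<subseteq> V \<and> (\<forall>y\<in>W. q (T y) = mat_act A (q y) + t)"
    using assms(1)[unfolded affine_at_def, THEN bspec, OF U(1)] V U(2)
    by (auto dest!: bspec[OF _ V(1)])
  thus thesis using that U(1) unfolding space by blast
qed

lemma affine_at_iff:
  assumes "affine_wrt T A t" "T ` R = R" "continuous_on Y T" "T ` Y \<subseteq> Y" and x: "x \<in> R"
  shows "affine_at S T B x \<longleftrightarrow> B = A"
proof
  assume "affine_at S T B x"
  moreover have "T x \<in> R" using assms by blast
  ultimately obtain U W s where W: "(U, q) \<in> charts S" "openin (top_of_set Y) W" "x \<in> W" "W \<subseteq> U"
    "\<And>y. y \<in> W \<Longrightarrow> q (T y) = mat_act B (q y) + s" using affine_atD[OF _ x] by metis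
  have "mat_act B (q y) + s = mat_act A (q y) + t" if "y \<in> W" for y
    using W(5)[OF that] assms(1) W(1,4) chart that by (metis subsetD)
  thus "B = A" using local_affine_unique[OF W(3,2,1,4)] by blast
next
  assume B: "B = A"
  have "\<exists>W s. openin (space_of S) W \<and> x \<in> W \<and> W \<subseteq> U \<and> T ` W \<subseteq> V \<and> (\<forall>y\<in>W. \<psi> (T y) = mat_act A (\<phi> y) + s)"
    if "(U,\<phi>) \<in> charts S" "(V,\<psi>) \<in> charts S" "x \<in> U" "T x \<in> V" for U V \<phi> \<psi>
  proof (intro exI conjI)
    have U: "openin (top_of_set Y) U" "U \<subseteq> R" "\<phi> = q" and V: "openin (top_of_set Y) V" "\<psi> = q"
      using chart that by blast+
    have "openin (top_of_set Y) (Y \<inter> T -` V)"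
      by (rule continuous_openin_preimage[OF assms(3) _ V(1)]) (use assms(4) in blast)
    thus "openin (space_of S) (U \<inter> (Y \<inter> T -` V))" using U space by auto
    show "x \<in> U \<inter> (Y \<inter> T -` V)" using that x regular_eq by auto
    show "\<forall>y\<in>U \<inter> (Y \<inter> T -` V). \<psi> (T y) = mat_act A (\<phi> y) + t" using U V assms(1) by auto
  qed auto
  thus "affine_at S T B x" unfolding affine_at_def B by (simp add: split_beta)
qed

lemma homeo_bij:
  assumes "homeomorphic_map (space_of S) (space_of S) T" "T ` cone_points S = cone_points S"
  shows "continuous_on Y T" "T ` Y = Y" "inj_on T Y" "T ` R = R"
proof -
  show T: "continuous_on Y T" "T ` Y = Y" "inj_on T Y"
    using assms(1) unfolding homeomorphic_eq_everything_map space by auto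
  thus "T ` R = R" using assms(2) cone unfolding regular_eq by (subst inj_on_image_set_diff[of T Y]) auto
qed

lemma Aff_plus_iff:
  "T \<in> Aff_plus S \<longleftrightarrow> T \<in> extensional Y \<and> homeomorphic_map (space_of S) (space_of S) T \<and>
     T ` cone_points S = cone_points S \<and> (\<exists>A t. det A > 0 \<and> affine_wrt T A t)" (is "?L \<longleftrightarrow> ?R")
proof
  assume ?L
  hence ext: "T \<in> extensional Y" and hom: "homeomorphic_map (space_of S) (space_of S) T"
    and co: "T ` cone_points S = cone_points S"
    and loc: "\<And>x. x \<in> R \<Longrightarrow> \<exists>A. affine_at S T A x"
    and pos: "\<And>x A. x \<in> R \<Longrightarrow> affine_at S T A x \<Longrightarrow> det A > 0"
    unfolding Aff_plus_def affine_diffeos_def space by auto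
  note T = homeo_bij[OF hom co]
  have "\<exists>U W A t. (U, q) \<in> charts S \<and> openin (top_of_set Y) W \<and> x \<in> W \<and> W \<subseteq> U \<and>
    (\<forall>y\<in>W. q (T y) = mat_act A (q y) + t)" if x: "x \<in> R" for x
  proof -
    obtain A where A: "affine_at S T A x" using loc[OF x] by blast
    have "T x \<in> R" using x T by blast
    from affine_atD[OF A x this] show ?thesis by metis
  qed
  then obtain U W A t where W: "\<And>x. x \<in> R \<Longrightarrow> (U x, q) \<in> charts S" "\<And>x. x \<in> R \<Longrightarrow> openin (top_of_set Y) (W x)"
    "\<And>x. x \<in> R \<Longrightarrow> x \<in> W x" "\<And>x. x \<in> R \<Longrightarrow> W x \<subseteq> U x"
    "\<And>x y. x \<in> R \<Longrightarrow> y \<in> W x \<Longrightarrow> q (T y) = mat_act (A x) (q y) + t x" by metis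
  have WR: "W x \<subseteq> R" if "x \<in> R" for x using W(1,4)[OF that] chart by blast
  have "(\<lambda>x. (A x, t x)) constant_on R"
  proof (rule locally_constant_imp_constant[OF connected_regular])
    fix a assume a: "a \<in> R"
    have "(A b, t b) = (A a, t a)" if b: "b \<in> W a" for b
    proof -
      have b': "b \<in> R" using WR a b by blast
      have "A b = A a \<and> t b = t a"
      proof (rule local_affine_unique)
        show "b \<in> W a \<inter> W b" "openin (top_of_set Y) (W a \<inter> W b)" using W a b b' by auto
        show "(U a, q) \<in> charts S" "W a \<inter> W b \<subseteq> U a" using W(1,4)[OF a] by blast+
        show "mat_act (A b) (q y) + t b = mat_act (A a) (q y) + t a" if "y \<in> W a \<inter> W b" for y
          using W(5)[OF a, of y] W(5)[OF b', of y] that by simp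
      qed
      thus ?thesis by simp
    qed
    moreover have "openin (top_of_set R) (W a)"
      using W(2)[OF a] WR[OF a] regular_eq openin_subset_trans by blast
    ultimately show "\<exists>N. openin (top_of_set R) N \<and> a \<in> N \<and> (\<forall>x\<in>N. (A x, t x) = (A a, t a))"
      using W(3)[OF a] by blast
  qed
  then obtain B s where Bs: "\<And>x. x \<in> R \<Longrightarrow> A x = B \<and> t x = s"
    unfolding constant_on_def by (metis prod.inject surj_pair)
  have glob: "affine_wrt T B s" using W(3,5) Bs by metis
  have "affine_at S T B x" if "x \<in> R" for x
    using affine_at_iff[OF glob T(4,1)] T(2) that by blast
  hence "det B > 0" using regular_nonempty pos by blast
  thus ?R using ext hom co glob by blast
next
  assume ?R
  then obtain A t where T: "T \<in> extensional Y" "homeomorphic_map (space_of S) (space_of S) T"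
    "T ` cone_points S = cone_points S" and A: "det A > 0" "affine_wrt T A t" by blast
  note H = homeo_bij[OF T(2,3)]
  have "affine_at S T B x \<longleftrightarrow> B = A" if "x \<in> R" for x B
    using affine_at_iff[OF A(2) H(4,1)] H(2) that by blast
  moreover have "invertible A" using A invertible_det_nz[of A] by simp
  ultimately show ?L using T A(1) unfolding Aff_plus_def affine_diffeos_def space by auto
qed

lemma Aff_plusD:
  assumes "T \<in> Aff_plus S"
  shows "homeomorphic_map (space_of S) (space_of S) T" "T ` cone_points S = cone_points S"
  using assms by (simp_all only: Aff_plus_iff)

lemma differential_eq:
  assumes "T \<in> Aff_plus S" "affine_wrt T A t"
  shows "differential S T = A"
proof -
  note H = homeo_bij[OF Aff_plusD[OF assms(1)]]
  have "affine_at S T B x \<longleftrightarrow> B = A" if "x \<in> R" for x B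
    using affine_at_iff[OF assms(2) H(4,1)] H(2) that by blast
  thus ?thesis unfolding differential_def using regular_nonempty by (intro the_equality) blast+
qed

section \<open>Veech groups as sets of matrices, and their group structure\<close>

lemma veech_groupE:
  assumes "A \<in> carrier (veech_group S)"
  obtains T t where "T \<in> Aff_plus S" "affine_wrt T A t" "det A > 0"
proof -
  obtain T where T: "T \<in> Aff_plus S" "A = differential S T"
    using assms unfolding veech_group_def by auto
  then obtain B t where B: "det B > 0" "affine_wrt T B t" unfolding Aff_plus_iff by blast
  have "A = B" unfolding T(2) by (rule differential_eq[OF T(1) B(2)])
  thus thesis using that[OF T(1)] B by blast
qed

lemma veech_groupI:
  assumes "T \<in> extensional Y" "homeomorphic_map (space_of S) (space_of S) T"
     "T ` cone_points S = cone_points S" "det A > 0" "affine_wrt T A t"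
  shows "A \<in> carrier (veech_group S)"
proof -
  have T: "T \<in> Aff_plus S" using assms unfolding Aff_plus_iff by blast
  have "A = differential S T" using differential_eq[OF T assms(5)] by (rule sym)
  thus ?thesis using T unfolding veech_group_def by auto
qed

lemma veech_group_image:
  assumes "A \<in> carrier (veech_group S)"
  shows "det A > 0 \<and> (\<exists>t. (\<lambda>x. mat_act A x + t) ` D = D)"
proof -
  obtain T t where T: "T \<in> Aff_plus S" "affine_wrt T A t" "det A > 0" using veech_groupE[OF assms] .
  have TR: "T ` R = R" by (rule homeo_bij(4)[OF Aff_plusD[OF T(1)]])
  have "(\<lambda>x. mat_act A x + t) ` D = q ` T ` R"
    unfolding onto[symmetric] image_image by (intro image_cong refl) (simp add: T(2))
  hence "(\<lambda>x. mat_act A x + t) ` D = D" unfolding TR onto .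
  thus ?thesis using T(3) by blast
qed

lemma one_in_veech_group: "mat 1 \<in> carrier (veech_group S)"
proof (rule veech_groupI)
  show "restrict id Y \<in> extensional Y" by simp
  show "homeomorphic_map (space_of S) (space_of S) (restrict id Y)"
    by (rule homeomorphic_map_eq[of _ _ id]) (auto simp: space)
  show "restrict id Y ` cone_points S = cone_points S" using cone by force
  show "affine_wrt (restrict id Y) (mat 1) 0" using regular_eq by auto
qed simp

lemma mult_in_veech_group:
  assumes "A \<in> carrier (veech_group S)" "B \<in> carrier (veech_group S)"
  shows "A ** B \<in> carrier (veech_group S)"
proof -
  obtain T t where T: "T \<in> Aff_plus S" "affine_wrt T A t" "det A > 0" using veech_groupE[OF assms(1)] .
  obtain T' t' where T': "T' \<in> Aff_plus S" "affine_wrt T' B t'" "det B > 0" using veech_groupE[OF assms(2)] .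
  note hT = Aff_plusD[OF T(1)] and hT' = Aff_plusD[OF T'(1)]
  show ?thesis
  proof (rule veech_groupI)
    show "restrict (T \<circ> T') Y \<in> extensional Y" by simp
    show "homeomorphic_map (space_of S) (space_of S) (restrict (T \<circ> T') Y)"
      by (rule homeomorphic_map_eq[OF homeomorphic_map_compose[OF hT'(1) hT(1)]]) (auto simp: space)
    have "restrict (T \<circ> T') Y ` cone_points S = T ` T' ` cone_points S"
      using cone by (auto simp: image_image intro!: image_cong)
    thus "restrict (T \<circ> T') Y ` cone_points S = cone_points S" using hT(2) hT'(2) by simp
    show "det (A ** B) > 0" using T(3) T'(3) by (simp add: det_mul)
    show "affine_wrt (restrict (T \<circ> T') Y) (A ** B) (mat_act A t' + t)"
    proof
      fix x assume x: "x \<in> R"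
      moreover have "T' x \<in> R" using x homeo_bij(4)[OF hT'] by blast
      ultimately show "q (restrict (T \<circ> T') Y x) = mat_act (A ** B) (q x) + (mat_act A t' + t)"
        using x bspec[OF T(2), of "T' x"] bspec[OF T'(2) x] regular_eq
        by (simp add: mat_act_mult mat_act_add)
    qed
  qed
qed

lemma inverse_in_veech_group:
  assumes "A \<in> carrier (veech_group S)"
  shows "\<exists>B \<in> carrier (veech_group S). A ** B = mat 1 \<and> B ** A = mat 1"
proof -
  obtain T t where T: "T \<in> Aff_plus S" "affine_wrt T A t" "det A > 0" using veech_groupE[OF assms(1)] .
  note hT = Aff_plusD[OF T(1)]
  have "invertible A" using T(3) invertible_det_nz[of A] by simp
  then obtain B where B: "A ** B = mat 1" "B ** A = mat 1" unfolding invertible_def by blast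
  have "det A * det B = 1" using B(1) by (metis det_I det_mul)
  hence "det B > 0" using T(3) by (metis zero_less_mult_pos zero_less_one)
  obtain T' where T': "homeomorphic_maps (space_of S) (space_of S) T T'"
    using hT(1) homeomorphic_map_maps by blast
  have inv: "T' (T x) = x" "T (T' x) = x" if "x \<in> Y" for x
    using T' that unfolding homeomorphic_maps_def space by auto
  have "B \<in> carrier (veech_group S)"
  proof (rule veech_groupI)
    show "restrict T' Y \<in> extensional Y" by simp
    have "homeomorphic_map (space_of S) (space_of S) T'"
      using T' homeomorphic_maps_sym homeomorphic_map_maps by blast
    thus "homeomorphic_map (space_of S) (space_of S) (restrict T' Y)"
      by (rule homeomorphic_map_eq) (auto simp: space)
    have "restrict T' Y (T x) = x" if "x \<in> cone_points S" for x
    proof -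
      have "T x \<in> Y" using that hT(2) cone by blast
      thus ?thesis using inv(1) that cone by auto
    qed
    hence "restrict T' Y ` T ` cone_points S = cone_points S"
      unfolding image_image by (simp only: image_ident cong: image_cong)
    thus "restrict T' Y ` cone_points S = cone_points S" unfolding hT(2) .
    show "det B > 0" by fact
    show "affine_wrt (restrict T' Y) B (- mat_act B t)"
    proof
      fix x assume x: "x \<in> R"
      then obtain y where y: "y \<in> R" "x = T y" using homeo_bij(4)[OF hT] by blast
      hence "q x = mat_act A (q y) + t" using T by blast
      hence "mat_act B (q x) = q y + mat_act B t"
        by (simp add: mat_act_add mat_act_mult[symmetric] B)
      moreover have "T' x = y" using y inv regular_eq by auto
      ultimately show "q (restrict T' Y x) = mat_act B (q x) + - mat_act B t"
        using x regular_eq by simp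
    qed
  qed
  thus ?thesis using B by blast
qed

end

lemma veech_group_simps:
  "mult (veech_group S) = (**)" "one (veech_group S) = mat 1"
  by (simp_all add: veech_group_def GL2_plus_def)

text \<open>\<open>subgroup\<close> refers to the inverse in the larger structure, a definite
  description over its carrier. The matrix inverse found in the smaller carrier lies in the larger
  one by \<open>sub\<close>, and two-sided matrix inverses are unique, so the description selects
  it.\<close>

lemma veech_group_subgroup:
  assumes S: "developed_surface S Y q D" and sub: "carrier (veech_group S) \<subseteq> carrier (veech_group S')"
  shows "subgroup (carrier (veech_group S)) (veech_group S')"
proof
  interpret developed_surface S Y q D by (rule S)
  show "carrier (veech_group S) \<subseteq> carrier (veech_group S')" by (rule sub)
  show "x \<otimes>\<^bsub>veech_group S'\<^esub> y \<in> carrier (veech_group S)"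
    if "x \<in> carrier (veech_group S)" "y \<in> carrier (veech_group S)" for x y
    using mult_in_veech_group[OF that] by (simp add: veech_group_simps)
  show "\<one>\<^bsub>veech_group S'\<^esub> \<in> carrier (veech_group S)"
    using one_in_veech_group by (simp add: veech_group_simps)
  show "inv\<^bsub>veech_group S'\<^esub> x \<in> carrier (veech_group S)" if x: "x \<in> carrier (veech_group S)" for x
  proof -
    obtain y where y: "y \<in> carrier (veech_group S)" "x ** y = mat 1" "y ** x = mat 1"
      using inverse_in_veech_group[OF x] by blast
    have "inv\<^bsub>veech_group S'\<^esub> x = y"
      unfolding m_inv_def veech_group_simps
    proof (rule the_equality)
      show "y \<in> carrier (veech_group S') \<and> x ** y = mat 1 \<and> y ** x = mat 1" using y sub by blast
      show "w = y" if "w \<in> carrier (veech_group S') \<and> x ** w = mat 1 \<and> w ** x = mat 1" for w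
        using that y by (metis matrix_mul_assoc matrix_mul_lid matrix_mul_rid)
    qed
    thus ?thesis using y by simp
  qed
qed

text \<open>Translates local homeomorphisms into the charts of \<open>pullback_surface\<close>. The
  hypothesis \<open>loc\<close> has the form that covering maps and explicit local sections provide;
  as the punctured plane is open, relative openness in it and openness in the plane
  coincide.\<close>

lemma developed_surface_pullback:
  fixes Y :: "'a::topological_space set"
  assumes D: "open (- range z)" and \<Sigma>: "\<Sigma> \<subseteq> Y" and con: "connected (Y - \<Sigma>)" "q ` (Y - \<Sigma>) = - range z"
    and loc: "\<And>x. x \<in> Y - \<Sigma> \<Longrightarrow>
      \<exists>U V r. openin (top_of_set Y) U \<and> x \<in> U \<and> U \<inter> \<Sigma> = {} \<and> open V \<and> V \<subseteq> - range z \<and> homeomorphism U V q r"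
  shows "developed_surface (pullback_surface (top_of_set Y) \<Sigma> q (punctured_plane z)) Y q (- range z)"
    (is "developed_surface ?S _ _ _")
proof -
  have reg: "regular_points ?S = Y - \<Sigma>" by (simp add: regular_points_def pullback_surface_def)
  have ch: "(U, \<phi>) \<in> charts ?S \<longleftrightarrow> \<phi> = q \<and> openin (top_of_set Y) U \<and> U \<inter> \<Sigma> = {} \<and> q ` U \<subseteq> - range z \<and>
     openin (top_of_set (- range z)) (q ` U) \<and>
     homeomorphic_map (top_of_set (Y \<inter> U)) (top_of_set (- range z \<inter> q ` U)) q" for U \<phi>
    by (auto simp: pullback_surface_def punctured_plane_def subtopology_subtopology o_def)
  have ne: "- range z \<noteq> {}"
    by (metis Compl_empty_eq countable_image countableI_type double_complement uncountable_UNIV_complex)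
  show ?thesis
  proof
    show "space_of ?S = top_of_set Y" "cone_points ?S \<subseteq> Y" using \<Sigma> by (auto simp: pullback_surface_def)
    show "\<phi> = q \<and> openin (top_of_set Y) U \<and> U \<subseteq> regular_points ?S" if "(U, \<phi>) \<in> charts ?S" for U \<phi>
      using that openin_imp_subset unfolding ch reg by blast
    show "open (q ` W)" if U: "(U, \<phi>) \<in> charts ?S" and W: "openin (top_of_set Y) W" "W \<subseteq> U" for U \<phi> W
    proof -
      have UY: "U \<subseteq> Y" "open (q ` U)" using U D openin_imp_subset unfolding ch by (blast, simp add: openin_open_eq)
      hence "open_map (top_of_set U) (top_of_set (q ` U)) q"
        using U homeomorphic_imp_open_map unfolding ch by (metis inf.absorb2)
      moreover have "openin (top_of_set U) W" using W UY openin_subset_trans by blast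
      ultimately have "openin (top_of_set (q ` U)) (q ` W)" by (simp add: open_map_def)
      thus ?thesis using UY openin_open_eq by blast
    qed
    show "\<exists>U. (U, q) \<in> charts ?S \<and> x \<in> U" if x: "x \<in> regular_points ?S" for x
    proof -
      obtain U V r where U: "openin (top_of_set Y) U" "x \<in> U" "U \<inter> \<Sigma> = {}" "open V" "V \<subseteq> - range z" "homeomorphism U V q r"
        using loc[OF x[unfolded reg]] by (elim exE conjE)
      have qU: "q ` U = V" using U(6) homeomorphism_image1 by blast
      have eq: "Y \<inter> U = U" "- range z \<inter> V = V" using U openin_imp_subset by blast+
      have "homeomorphic_maps (top_of_set U) (top_of_set V) q r"
        using U(6) unfolding homeomorphism_def homeomorphic_maps_def by auto
      hence "homeomorphic_map (top_of_set U) (top_of_set V) q" using homeomorphic_map_maps by blast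
      hence "(U, q) \<in> charts ?S" unfolding ch qU eq using U D by (auto simp: openin_open_eq)
      thus ?thesis using U by blast
    qed
    show "connected (regular_points ?S)" "regular_points ?S \<noteq> {}" "q ` regular_points ?S = - range z"
      using con ne unfolding reg by auto
  qed
qed

section \<open>The Veech group of the punctured plane\<close>

lemma affine_image_complement:
  assumes "det A > 0"
  shows "(\<lambda>x. mat_act A x + t) ` (- Z) = - Z \<longleftrightarrow> (\<lambda>x. mat_act A x + t) ` Z = Z"
proof -
  obtain B where B: "\<And>x. mat_act B (mat_act A x) = x" "\<And>x. mat_act A (mat_act B x) = x"
    using affine_bij[OF assms] by blast
  have "bij (\<lambda>x. mat_act A x + t)"
    by (rule o_bij[of "\<lambda>y. mat_act B (y - t)"]) (auto simp: fun_eq_iff B)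
  thus ?thesis by (simp add: bij_image_Compl_eq)
qed

lemma developed_surface_punctured_plane:
  assumes lim: "filterlim (\<lambda>k. norm (z k)) at_top sequentially"
  shows "developed_surface (punctured_plane z) (- range z) (\<lambda>x. x) (- range z)"
proof -
  have op: "open (- range z)" using closed_range_if_tendsto_infinity[OF lim] by blast
  have con: "connected (- range z)"
    by (intro path_connected_imp_connected path_connected_complement_countable) auto
  have ne: "- range z \<noteq> {}"
    by (metis Compl_empty_eq countable_image countableI_type double_complement uncountable_UNIV_complex)
  show ?thesis
    by unfold_locales (use op con ne in \<open>auto simp: punctured_plane_def regular_points_def openin_open_eq\<close>)
qed

text \<open>The right-hand side mentions no surface. The carrier for the universal cover is reduced
  to the same set, so the two groups are compared without relating their affine diffeomorphisms
  directly.\<close>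

lemma carrier_veech_group_punctured_plane:
  assumes lim: "filterlim (\<lambda>k. norm (z k)) at_top sequentially"
  shows "carrier (veech_group (punctured_plane z)) =
    {A. det A > 0 \<and> (\<exists>t. (\<lambda>x. mat_act A x + t) ` (- range z) = - range z)}"
proof -
  interpret developed_surface "punctured_plane z" "- range z" "\<lambda>x. x" "- range z"
    by (rule developed_surface_punctured_plane[OF lim])
  have "A \<in> carrier (veech_group (punctured_plane z))"
    if A: "det A > 0" "(\<lambda>x. mat_act A x + t) ` (- range z) = - range z" for A t
  proof -
    let ?T = "restrict (\<lambda>x. mat_act A x + t) (- range z)"
    have T: "?T \<in> Aff_plus (punctured_plane z)"
      unfolding Aff_plus_punctured_plane[OF lim]
      by (intro CollectI exI conjI refl) (use A affine_image_complement[OF A(1)] in simp_all)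
    moreover have "\<forall>x\<in>R. ?T x = mat_act A x + t" using regular_eq by auto
    ultimately have "differential (punctured_plane z) ?T = A" by (rule differential_eq)
    hence "A \<in> differential (punctured_plane z) ` Aff_plus (punctured_plane z)"
      by (intro rev_image_eqI[OF T]) (rule sym)
    thus ?thesis by (simp add: veech_group_def)
  qed
  thus ?thesis using veech_group_image by blast
qed

section \<open>Lifting in covering spaces\<close>

text \<open>
  The lifting theorems of HOL-Analysis require the total space to lie in a normed vector space.  Not
  even the Hausdorff property is needed: distinct points of a fibre lie in disjoint sheets.
\<close>

lemma covering_space_sheet:
  assumes cov: "covering_space C p S" and x: "x \<in> C"
  obtains V \<V> u q where "p x \<in> V" "openin (top_of_set S) V" "\<Union>\<V> = C \<inter> p -` V"
    "\<And>u. u \<in> \<V> \<Longrightarrow> openin (top_of_set C) u" "pairwise disjnt \<V>"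
    "u \<in> \<V>" "x \<in> u" "homeomorphism u V p q"
proof -
  have "p x \<in> S" using cov x by (auto simp: covering_space_def)
  then obtain V \<V> where V: "p x \<in> V" "openin (top_of_set S) V" "\<Union>\<V> = C \<inter> p -` V"
    "\<forall>u\<in>\<V>. openin (top_of_set C) u" "pairwise disjnt \<V>" "\<forall>u\<in>\<V>. \<exists>q. homeomorphism u V p q"
    using cov unfolding covering_space_def by meson
  then obtain u where u: "u \<in> \<V>" "x \<in> u" using x by blast
  then obtain q where "homeomorphism u V p q" using V by blast
  thus thesis using that[of V \<V> u q] V u by auto
qed

text \<open>The truth value of \<open>g1 x = g2 x\<close> is locally constant. Near \<open>y\<close>
  each lift stays in one sheet: if it is the same sheet, injectivity of \<open>p\<close> forces
  equality; if the sheets differ, disjointness forbids it.\<close>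

lemma covering_space_lift_unique_general:
  fixes p :: "'a::topological_space \<Rightarrow> 'b::topological_space"
    and g1 :: "'c::topological_space \<Rightarrow> 'a"
  assumes cov: "covering_space C p S" and con: "connected T"
    and g1: "continuous_on T g1" "g1 \<in> T \<rightarrow> C" and g2: "continuous_on T g2" "g2 \<in> T \<rightarrow> C"
    and eq: "\<And>x. x \<in> T \<Longrightarrow> p (g1 x) = p (g2 x)"
    and a: "a \<in> T" "g1 a = g2 a" and x: "x \<in> T"
  shows "g1 x = g2 x"
proof -
  have "(\<lambda>x. g1 x = g2 x) constant_on T"
  proof (rule locally_constant_imp_constant[OF con])
    fix y assume y: "y \<in> T"
    hence y1: "g1 y \<in> C" and y2: "g2 y \<in> C" using g1 g2 by auto
    obtain V \<V> u1 q where V: "p (g1 y) \<in> V" "openin (top_of_set S) V" "\<Union>\<V> = C \<inter> p -` V"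
      "\<And>u. u \<in> \<V> \<Longrightarrow> openin (top_of_set C) u" "pairwise disjnt \<V>"
      "u1 \<in> \<V>" "g1 y \<in> u1" "homeomorphism u1 V p q"
      by (rule covering_space_sheet[OF cov y1]) blast
    obtain u2 where u2: "u2 \<in> \<V>" "g2 y \<in> u2" using V y2 eq[OF y] by auto
    have inj: "a = b" if "a \<in> u1" "b \<in> u1" "p a = p b" for a b
      using V(8) that by (metis homeomorphism_apply1)
    let ?N = "(T \<inter> g1 -` u1) \<inter> (T \<inter> g2 -` u2)"
    have same: "(g1 w = g2 w) = (g1 y = g2 y)" if "w \<in> ?N" for w
    proof (cases "u1 = u2")
      case True
      hence "g1 w = g2 w" "g1 y = g2 y" using inj that V u2 eq y by auto
      thus ?thesis by simp
    next
      case False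
      hence "disjnt u1 u2" using V u2 by (auto simp: pairwise_def)
      thus ?thesis using that V u2 by (auto simp: disjnt_iff)
    qed
    have "openin (top_of_set T) ?N"
      using g1 g2 V u2 by (intro openin_Int continuous_openin_preimage) auto
    thus "\<exists>N. openin (top_of_set T) N \<and> y \<in> N \<and> (\<forall>x\<in>N. (g1 x = g2 x) = (g1 y = g2 y))"
      using y V(7) u2(2) same by blast
  qed
  then obtain c where "\<And>y. y \<in> T \<Longrightarrow> (g1 y = g2 y) = c" unfolding constant_on_def by blast
  thus ?thesis using a x by blast
qed

section \<open>Existence of lifts over the unit square\<close>

text \<open>The initial value may be prescribed at any point of \<open>R\<close> and anywhere in its
  fibre. This freedom lets a second piece be started at whatever point it shares with the
  first.\<close>

definition lifts_over ::
  "'a::topological_space set \<Rightarrow> ('a \<Rightarrow> 'b) \<Rightarrow> ('c::topological_space \<Rightarrow> 'b) \<Rightarrow> 'c set \<Rightarrow> bool"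
  where "lifts_over C p h R \<longleftrightarrow>
    (\<forall>r\<in>R. \<forall>e\<in>C. p e = h r \<longrightarrow>
      (\<exists>k. continuous_on R k \<and> k \<in> R \<rightarrow> C \<and> (\<forall>x\<in>R. p (k x) = h x) \<and> k r = e))"

text \<open>The second lift is started at a common point with the value of the first. Uniqueness on
  the connected intersection makes the two agree there, and closedness of the pieces makes the union
  continuous.\<close>

lemma lifts_over_glue_aux:
  assumes cov: "covering_space C p S"
    and R: "lifts_over C p h R1" "lifts_over C p h R2" "closed R1" "closed R2"
    and con: "connected (R1 \<inter> R2)" "R1 \<inter> R2 \<noteq> {}"
    and r: "r \<in> R1" and e: "e \<in> C" "p e = h r"
  shows "\<exists>k. continuous_on (R1 \<union> R2) k \<and> k \<in> R1 \<union> R2 \<rightarrow> C \<and> (\<forall>x\<in>R1 \<union> R2. p (k x) = h x) \<and> k r = e"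
proof -
  obtain k1 where k1: "continuous_on R1 k1" "k1 \<in> R1 \<rightarrow> C" "\<And>x. x \<in> R1 \<Longrightarrow> p (k1 x) = h x" "k1 r = e"
    using R(1) r e unfolding lifts_over_def by blast
  obtain c where c: "c \<in> R1" "c \<in> R2" using con by blast
  have "k1 c \<in> C" "p (k1 c) = h c" using k1 c by auto
  then obtain k2 where k2: "continuous_on R2 k2" "k2 \<in> R2 \<rightarrow> C" "\<And>x. x \<in> R2 \<Longrightarrow> p (k2 x) = h x" "k2 c = k1 c"
    using R(2) c unfolding lifts_over_def by blast
  have agree: "k1 x = k2 x" if "x \<in> R1 \<inter> R2" for x
    by (rule covering_space_lift_unique_general[OF cov con(1), of k1 k2 c])
      (use k1 k2 c that in \<open>auto intro: continuous_on_subset\<close>)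
  let ?k = "\<lambda>x. if x \<in> R1 then k1 x else k2 x"
  have "continuous_on (R1 \<union> R2) ?k"
    using R k1 k2 agree by (intro continuous_on_cases) auto
  thus ?thesis using k1 k2 r by (intro exI[of _ ?k]) auto
qed

lemma lifts_over_glue:
  assumes "covering_space C p S" "lifts_over C p h R1" "lifts_over C p h R2" "closed R1" "closed R2"
    "connected (R1 \<inter> R2)" "R1 \<inter> R2 \<noteq> {}"
  shows "lifts_over C p h (R1 \<union> R2)"
  unfolding lifts_over_def
proof (intro ballI impI)
  fix r e assume "r \<in> R1 \<union> R2" and e: "e \<in> C" "p e = h r"
  then consider "r \<in> R1" | "r \<in> R2" by blast
  thus "\<exists>k. continuous_on (R1 \<union> R2) k \<and> k \<in> R1 \<union> R2 \<rightarrow> C \<and> (\<forall>x\<in>R1 \<union> R2. p (k x) = h x) \<and> k r = e"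
  proof cases
    case 1
    show ?thesis by (rule lifts_over_glue_aux[OF assms 1 e])
  next
    case 2
    show ?thesis
      unfolding Un_commute[of R1 R2]
      by (rule lifts_over_glue_aux[OF assms(1,3,2,5,4) _ _ 2 e]) (use assms(6,7) in \<open>simp_all add: Int_commute\<close>)
  qed
qed

text \<open>Over an evenly covered set, \<open>h\<close> followed by the inverse of the sheet
  through the prescribed point is a lift.\<close>

lemma lifts_over_subset_evenly_covered:
  assumes cov: "covering_space C p S" and D: "continuous_on D h" "h \<in> D \<rightarrow> S" "x \<in> D"
  shows "\<exists>N. openin (top_of_set D) N \<and> x \<in> N \<and> (\<forall>R\<subseteq>N. lifts_over C p h R)"
proof -
  have "h x \<in> S" using D by auto
  then obtain V \<V> where V: "h x \<in> V" "openin (top_of_set S) V" "\<Union>\<V> = C \<inter> p -` V"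
    "\<forall>u\<in>\<V>. \<exists>q. homeomorphism u V p q"
    using cov unfolding covering_space_def by meson
  have "lifts_over C p h R" if R: "R \<subseteq> D \<inter> h -` V" for R
    unfolding lifts_over_def
  proof (intro ballI impI)
    fix r e assume r: "r \<in> R" and e: "e \<in> C" "p e = h r"
    have "e \<in> C \<inter> p -` V" using r e R by auto
    then obtain u where u: "u \<in> \<V>" "e \<in> u" using V(3) by blast
    then obtain q where q: "homeomorphism u V p q" using V by blast
    have "continuous_on R (q \<circ> h)"
      by (rule continuous_on_compose)
        (use R D q homeomorphism_cont2 in \<open>blast intro: continuous_on_subset\<close>)+
    moreover have "q (h y) \<in> u" if "y \<in> R" for y
      using that R homeomorphism_image2[OF q] by blast
    moreover have "u \<subseteq> C" using u V by blast
    ultimately show "\<exists>k. continuous_on R k \<and> k \<in> R \<rightarrow> C \<and> (\<forall>x\<in>R. p (k x) = h x) \<and> k r = e"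
      using R homeomorphism_apply2[OF q] homeomorphism_apply1[OF q] u e
      by (intro exI[of _ "q \<circ> h"]) (auto, metis)
  qed
  moreover have "openin (top_of_set D) (D \<inter> h -` V)"
    using D V by (intro continuous_openin_preimage) auto
  ultimately show ?thesis using D V by blast
qed

text \<open>Bisection in both directions takes the place of a Lebesgue number. The inner use of
  \<open>Bolzano\<close> stacks rectangles into a strip of full height over every narrow interval
  around \<open>s\<close>, as in the tube lemma; the outer one joins such strips side by
  side.\<close>

lemma lifts_over_square:
  fixes h :: "real \<times> real \<Rightarrow> 'b::topological_space"
  assumes cov: "covering_space C p S"
    and h: "continuous_on ({0..1} \<times> {0..1}) h" "h \<in> {0..1} \<times> {0..1} \<rightarrow> S"
  shows "lifts_over C p h ({0..1} \<times> {0..1})"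
proof -
  let ?L = "\<lambda>a b c d. lifts_over C p h ({a..b} \<times> {c..d})"
  have hor: "?L a b c e" if "?L a b c d" "?L a b d e" "a \<le> b" "c \<le> d" "d \<le> e" for a b c d e
  proof -
    have "({a..b} \<times> {c..d}) \<inter> ({a..b} \<times> {d..e}) = {a..b} \<times> {d}"
      "({a..b} \<times> {c..d}) \<union> ({a..b} \<times> {d..e}) = {a..b} \<times> {c..e}" using that by auto
    thus ?thesis using lifts_over_glue[OF cov that(1,2)] that
      by (simp add: closed_Times connected_Times)
  qed
  have ver: "?L a c d e" if "?L a b d e" "?L b c d e" "d \<le> e" "a \<le> b" "b \<le> c" for a b c d e
  proof -
    have "({a..b} \<times> {d..e}) \<inter> ({b..c} \<times> {d..e}) = {b} \<times> {d..e}"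
      "({a..b} \<times> {d..e}) \<union> ({b..c} \<times> {d..e}) = {a..c} \<times> {d..e}" using that by auto
    thus ?thesis using lifts_over_glue[OF cov that(1,2)] that
      by (simp add: closed_Times connected_Times)
  qed
  have loc: "\<exists>e>0. \<forall>a b c d. 0 \<le> a \<and> b \<le> 1 \<and> 0 \<le> c \<and> d \<le> 1 \<and>
      a \<le> s \<and> s \<le> b \<and> c \<le> t \<and> t \<le> d \<and> b - a < e \<and> d - c < e \<longrightarrow> ?L a b c d"
    if st: "s \<in> {0..1}" "t \<in> {0..1}" for s t
  proof -
    obtain N where N: "openin (top_of_set ({0..1} \<times> {0..1})) N" "(s,t) \<in> N" "\<And>R. R \<subseteq> N \<Longrightarrow> lifts_over C p h R"
      using lifts_over_subset_evenly_covered[OF cov h, of "(s,t)"] st by auto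
    then obtain e where e: "e > 0" "ball (s,t) e \<inter> ({0..1} \<times> {0..1}) \<subseteq> N"
      by (meson openin_contains_ball)
    \<comment> \<open>Half the radius suffices because the distance is at most the sum of the two
      coordinate differences.\<close>
    have "{a..b} \<times> {c..d} \<subseteq> N" if "0 \<le> a" "b \<le> 1" "0 \<le> c" "d \<le> 1"
      "a \<le> s" "s \<le> b" "c \<le> t" "t \<le> d" "b - a < e/2" "d - c < e/2" for a b c d
    proof (clarify, rule subsetD[OF e(2)], safe)
      fix x y assume xy: "x \<in> {a..b}" "y \<in> {c..d}"
      have "dist (s,t) (x,y) \<le> \<bar>s - x\<bar> + \<bar>t - y\<bar>"
        by (simp add: dist_Pair_Pair dist_real_def sqrt_sum_squares_le_sum_abs)
      also have "\<dots> < e" using xy that by auto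
      finally show "(x,y) \<in> ball (s,t) e" by simp
      show "x \<in> {0..1}" "y \<in> {0..1}" using xy that by auto
    qed
    thus ?thesis using e N(3) by (intro exI[of _ "e/2"]) auto
  qed
  \<comment> \<open>The premise \<open>0 \<le> c \<and> d \<le> 1\<close> makes \<open>P\<close>
    hold vacuously on intervals that leave the unit interval; the local hypothesis of
    \<open>Bolzano\<close> quantifies over those too.\<close>
  define P where "P s c d \<longleftrightarrow> 0 \<le> c \<and> d \<le> 1 \<longrightarrow>
    (\<exists>e>0. \<forall>a b. 0 \<le> a \<and> b \<le> 1 \<and> a \<le> s \<and> s \<le> b \<and> b - a < e \<longrightarrow> ?L a b c d)" for s c d
  have P: "P s 0 1" if s: "s \<in> {0..1}" for s
  proof (rule Bolzano[where P = "P s"])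
    show "(0::real) \<le> 1" by simp
    fix c d e :: real assume cde: "P s c d" "P s d e" "c \<le> d" "d \<le> e"
    show "P s c e" unfolding P_def
    proof
      assume "0 \<le> c \<and> e \<le> 1"
      then obtain e1 e2 where "e1 > 0" "e2 > 0"
        and "\<And>a b. 0 \<le> a \<Longrightarrow> b \<le> 1 \<Longrightarrow> a \<le> s \<Longrightarrow> s \<le> b \<Longrightarrow> b - a < e1 \<Longrightarrow> ?L a b c d"
        and "\<And>a b. 0 \<le> a \<Longrightarrow> b \<le> 1 \<Longrightarrow> a \<le> s \<Longrightarrow> s \<le> b \<Longrightarrow> b - a < e2 \<Longrightarrow> ?L a b d e"
        using cde unfolding P_def by (smt (verit))
      thus "\<exists>e'>0. \<forall>a b. 0 \<le> a \<and> b \<le> 1 \<and> a \<le> s \<and> s \<le> b \<and> b - a < e' \<longrightarrow> ?L a b c e"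
        using cde(3,4) by (intro exI[of _ "min e1 e2"] conjI allI impI hor[of _ _ c d e]) auto
    qed
  next
    fix t :: real assume "0 \<le> t" "t \<le> 1"
    then obtain e where e: "e > 0" "\<forall>a b c d. 0 \<le> a \<and> b \<le> 1 \<and> 0 \<le> c \<and> d \<le> 1 \<and>
      a \<le> s \<and> s \<le> b \<and> c \<le> t \<and> t \<le> d \<and> b - a < e \<and> d - c < e \<longrightarrow> ?L a b c d"
      using loc[OF s, of t] by auto
    show "\<exists>\<delta>>0. \<forall>c d. c \<le> t \<and> t \<le> d \<and> d - c < \<delta> \<longrightarrow> P s c d"
      using e unfolding P_def by blast
  qed
  have "0 \<le> (0::real) \<and> (1::real) \<le> 1 \<longrightarrow> ?L 0 1 0 1"
  proof (rule Bolzano[where P = "\<lambda>a b. 0 \<le> a \<and> b \<le> 1 \<longrightarrow> ?L a b 0 1"])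
    show "(0::real) \<le> 1" by simp
    show "0 \<le> a \<and> c \<le> 1 \<longrightarrow> ?L a c 0 1"
      if "0 \<le> a \<and> b \<le> 1 \<longrightarrow> ?L a b 0 1" "0 \<le> b \<and> c \<le> 1 \<longrightarrow> ?L b c 0 1" "a \<le> b" "b \<le> c" for a b c
      using that ver[of a b 0 1 c] by auto
    fix s :: real assume "0 \<le> s" "s \<le> 1"
    hence "P s 0 1" using P by auto
    thus "\<exists>d>0. \<forall>a b. a \<le> s \<and> s \<le> b \<and> b - a < d \<longrightarrow> 0 \<le> a \<and> b \<le> 1 \<longrightarrow> ?L a b 0 1"
      unfolding P_def by auto
  qed
  thus ?thesis by simp
qed

text \<open>A path is treated as a map on the square that depends on the second coordinate only; the
  left edge of the lifted square is the lifted path.\<close>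

lemma lifts_over_path:
  fixes g :: "real \<Rightarrow> 'b::topological_space"
  assumes cov: "covering_space C p S" and g: "path g" "path_image g \<subseteq> S"
    and e: "e \<in> C" "p e = pathstart g"
  obtains k where "path k" "path_image k \<subseteq> C" "pathstart k = e" "\<And>t. t \<in> {0..1} \<Longrightarrow> p (k t) = g t"
proof -
  have "continuous_on ({0..1::real} \<times> {0..1}) (g \<circ> snd)"
    using g unfolding path_def
    by (intro continuous_on_compose continuous_intros continuous_on_subset[OF g(1)[unfolded path_def]]) auto
  moreover have "g \<circ> snd \<in> {0..1::real} \<times> {0..1} \<rightarrow> S" using g by (auto simp: path_image_def)
  ultimately have "lifts_over C p (g \<circ> snd) ({0..1::real} \<times> {0..1})"
    by (rule lifts_over_square[OF cov])
  then obtain K where K: "continuous_on ({0..1::real} \<times> {0..1}) K" "K \<in> {0..1} \<times> {0..1} \<rightarrow> C"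
    "\<And>x. x \<in> {0..1} \<times> {0..1} \<Longrightarrow> p (K x) = g (snd x)" "K (0,0) = e"
    using e unfolding lifts_over_def pathstart_def by (force dest!: bspec[of _ _ "(0,0)"] bspec[of C _ e])
  have "path (\<lambda>t. K (0,t))" unfolding path_def
    by (rule continuous_on_compose2[OF K(1)]) (auto intro: continuous_intros)
  moreover have "path_image (\<lambda>t. K (0,t)) \<subseteq> C" using K(2) by (auto simp: path_image_def)
  ultimately show thesis using K(3,4) by (intro that[of "\<lambda>t. K (0,t)"]) (simp_all add: pathstart_def)
qed

section \<open>The lifting criterion and lifts of homeomorphisms\<close>

text \<open>A neighbourhood is cut down to a sheet, pushed down by \<open>p\<close>, refined in
  \<open>S\<close>, and brought back by the inverse of the sheet. This allows the covering space
  itself to be the domain in the lifting criterion.\<close>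

lemma locally_path_connected_covering:
  fixes p :: "'a::topological_space \<Rightarrow> 'b::topological_space"
  assumes cov: "covering_space C p S" and S: "locally path_connected S"
  shows "locally path_connected C"
proof (rule locallyI)
  fix W x assume W: "openin (top_of_set C) W" "x \<in> W"
  hence x: "x \<in> C" using openin_imp_subset by blast
  obtain V \<V> u q where V: "p x \<in> V" "openin (top_of_set S) V" "\<And>u. u \<in> \<V> \<Longrightarrow> openin (top_of_set C) u"
      "u \<in> \<V>" "x \<in> u" "homeomorphism u V p q"
    by (rule covering_space_sheet[OF cov x]) blast
  have "openin (top_of_set C) (u \<inter> W)" "u \<subseteq> C" using W V openin_imp_subset by blast+
  hence "openin (top_of_set u) (u \<inter> W)" by (metis inf_le1 openin_subset_trans)
  moreover have hom': "homeomorphism V u q p" using V homeomorphism_symD by blast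
  ultimately have "openin (top_of_set V) (p ` (u \<inter> W))"
    using homeomorphism_imp_open_map[OF V(6)] by blast
  hence "openin (top_of_set S) (p ` (u \<inter> W))" using V openin_trans by blast
  then obtain A B where AB: "openin (top_of_set S) A" "path_connected B" "p x \<in> A" "A \<subseteq> B" "B \<subseteq> p ` (u \<inter> W)"
    using locallyE[OF S, of "p ` (u \<inter> W)" "p x"] V W by blast
  have BV: "B \<subseteq> V" using AB homeomorphism_image1[OF V(6)] by blast
  have "openin (top_of_set V) A" using AB BV V openin_subset_trans openin_imp_subset by (metis order_trans)
  hence "openin (top_of_set u) (q ` A)" using homeomorphism_imp_open_map[OF hom'] by blast
  hence "openin (top_of_set C) (q ` A)" using V openin_trans by blast
  moreover have "path_connected (q ` B)"
    by (intro path_connected_continuous_image continuous_on_subset[OF homeomorphism_cont2[OF V(6)]] AB BV)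
  moreover have "q ` B \<subseteq> W" 
    using AB(5) homeomorphism_apply1[OF V(6)] by fastforce
  moreover have "x \<in> q ` A" using AB V by (metis homeomorphism_apply1 imageI)
  ultimately show "\<exists>U V. openin (top_of_set C) U \<and> path_connected V \<and> x \<in> U \<and> U \<subseteq> V \<and> V \<subseteq> W"
    using AB by blast
qed

text \<open>
  Lifting a free null homotopy of a loop already shows that the lift of the loop closes up,
  because the end of the lifted homotopy lies over a constant path.
\<close>

lemma lift_of_null_homotopic_loop_closed:
  fixes k :: "real \<Rightarrow> 'a::topological_space" and p :: "'a \<Rightarrow> 'b::topological_space"
  assumes cov: "covering_space C p S" and hom: "homotopic_loops S l (\<lambda>_. b)"
    and k: "path k" "path_image k \<subseteq> C" "\<And>t. t \<in> {0..1} \<Longrightarrow> p (k t) = l t"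
  shows "pathfinish k = pathstart k"
proof -
  let ?I = "{0..1::real}"
  obtain h where h: "continuous_on (?I \<times> ?I) h" "h \<in> ?I \<times> ?I \<rightarrow> S"
     "\<And>x. x \<in> ?I \<Longrightarrow> h (0,x) = l x" "\<And>x. x \<in> ?I \<Longrightarrow> h (1,x) = b"
     "\<And>t. t \<in> ?I \<Longrightarrow> h (t,0) = h (t,1)"
    using hom unfolding homotopic_loops by (auto simp: pathfinish_def pathstart_def)
  have k0: "k 0 \<in> C" "p (k 0) = h (0,0)" using k(2,3) h(3)[of 0] by (auto simp: path_image_def)
  then obtain K where K: "continuous_on (?I \<times> ?I) K" "K \<in> ?I \<times> ?I \<rightarrow> C"
    "\<And>x. x \<in> ?I \<times> ?I \<Longrightarrow> p (K x) = h x" "K (0,0) = k 0"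
    using lifts_over_square[OF cov h(1,2)] unfolding lifts_over_def by fastforce
  have edge: "continuous_on ?I (\<lambda>t. K (s,t))" "continuous_on ?I (\<lambda>t. K (t,s))" if "s \<in> ?I" for s
    using that by (auto intro!: continuous_on_compose2[OF K(1)] continuous_intros)
  have "K (0,1) = k 1"
    by (rule covering_space_lift_unique_general[OF cov, of ?I "\<lambda>t. K (0,t)" k 0])
      (use k K h edge in \<open>auto simp: path_def path_image_def\<close>)
  moreover have top: "K (1,1) = K (1,0)"
    by (rule covering_space_lift_unique_general[OF cov, of ?I "\<lambda>t. K (1,t)" "\<lambda>_. K (1,0)" 0])
      (use K h edge in auto)
  \<comment> \<open>The two vertical sides of the homotopy have the same image under
    \<open>h\<close>. Their lifts agree at \<open>s = 1\<close> by \<open>top\<close>, and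
    uniqueness carries this back to \<open>s = 0\<close>.\<close>
  moreover have "K (0,1) = K (0,0)"
    by (rule covering_space_lift_unique_general[OF cov, of ?I "\<lambda>s. K (s,1)" "\<lambda>s. K (s,0)" 1])
      (use K h edge top in auto)
  ultimately show ?thesis using K by (simp add: pathfinish_def pathstart_def)
qed

text \<open>\<open>simply_connected\<close> makes any two loops homotopic, constant ones included;
  following one parameter of such a homotopy joins the two points.\<close>

lemma simply_connected_imp_path_connected_general:
  fixes U :: "'a::topological_space set"
  assumes "simply_connected U"
  shows "path_connected U"
  unfolding path_connected_component
proof (intro ballI)
  fix x y assume "x \<in> U" "y \<in> U"
  hence "homotopic_loops U (\<lambda>_. x) (\<lambda>_. y)"
    using assms[unfolded simply_connected_def, rule_format, of "\<lambda>_. x" "\<lambda>_. y"]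
    by (auto simp: path_def path_image_def pathstart_def pathfinish_def)
  thus "path_component U x y"
    using homotopic_loops_imp_path_component_value[of U "\<lambda>_. x" "\<lambda>_. y" 0] by simp
qed

text \<open>The value at \<open>y\<close> is the end of the lift of \<open>f\<close> along a path
  from \<open>z\<close> to \<open>y\<close>. The relation \<open>E\<close> collects all such ends:
  path connectedness makes it total, closing of lifted loops makes it single-valued, and local path
  connectedness gives continuity.\<close>

lemma simply_connected_lift_exists:
  fixes p :: "'a::topological_space \<Rightarrow> 'b::topological_space"
    and f :: "'c::topological_space \<Rightarrow> 'b"
  assumes cov: "covering_space C p S" and U: "simply_connected U" "locally path_connected U"
    and f: "continuous_on U f" "f \<in> U \<rightarrow> S" and z: "z \<in> U" and a: "a \<in> C" "p a = f z"
  obtains g where "continuous_on U g" "g \<in> U \<rightarrow> C" "\<And>y. y \<in> U \<Longrightarrow> p (g y) = f y" "g z = a"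
proof -
  define E where "E y w \<longleftrightarrow> (\<exists>\<gamma> k. path \<gamma> \<and> path_image \<gamma> \<subseteq> U \<and> pathstart \<gamma> = z \<and> pathfinish \<gamma> = y \<and>
    path k \<and> path_image k \<subseteq> C \<and> pathstart k = a \<and> pathfinish k = w \<and> (\<forall>t\<in>{0..1}. p (k t) = f (\<gamma> t)))" for y w
  have pc: "path_connected U" by (rule simply_connected_imp_path_connected_general[OF U(1)])
  have fpath: "path (f \<circ> \<gamma>)" "path_image (f \<circ> \<gamma>) \<subseteq> S" if "path \<gamma>" "path_image \<gamma> \<subseteq> U" for \<gamma>
    using that f by (auto intro!: path_continuous_image continuous_on_subset[OF f(1)] simp: path_image_compose)
  have ex: "\<exists>w. E y w" if "y \<in> U" for y
  proof -
    obtain \<gamma> where \<gamma>: "path \<gamma>" "path_image \<gamma> \<subseteq> U" "pathstart \<gamma> = z" "pathfinish \<gamma> = y"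
      using pc[unfolded path_connected_def, rule_format, OF z \<open>y \<in> U\<close>] by blast
    have "p a = pathstart (f \<circ> \<gamma>)" using a \<gamma> by (simp add: pathstart_compose)
    then obtain k where
      "path k" "path_image k \<subseteq> C" "pathstart k = a" "\<And>t. t \<in> {0..1} \<Longrightarrow> p (k t) = (f \<circ> \<gamma>) t"
      by (rule lifts_over_path[OF cov fpath[OF \<gamma>(1,2)] a(1)]) blast
    with \<gamma> have "E y (pathfinish k)" unfolding E_def by (intro exI[of _ \<gamma>] exI[of _ k]) auto
    thus ?thesis by blast
  qed
  have uniq: "v = w" if "E y v" "E y w" for y v w
  proof -
    obtain \<gamma> k where \<gamma>: "path \<gamma>" "path_image \<gamma> \<subseteq> U" "pathstart \<gamma> = z" "pathfinish \<gamma> = y"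
      and k: "path k" "path_image k \<subseteq> C" "pathstart k = a" "pathfinish k = v" "\<And>t. t \<in> {0..1} \<Longrightarrow> p (k t) = f (\<gamma> t)"
      using \<open>E y v\<close> unfolding E_def by blast
    obtain \<delta> m where \<delta>: "path \<delta>" "path_image \<delta> \<subseteq> U" "pathstart \<delta> = z" "pathfinish \<delta> = y"
      and m: "path m" "path_image m \<subseteq> C" "pathstart m = a" "pathfinish m = w" "\<And>t. t \<in> {0..1} \<Longrightarrow> p (m t) = f (\<delta> t)"
      using \<open>E y w\<close> unfolding E_def by blast
    have vC: "v \<in> C" "p v = pathstart (f \<circ> reversepath \<delta>)"
      using k \<gamma> \<delta> pathfinish_in_path_image[of k] by (auto simp: pathfinish_def pathstart_def reversepath_def)
    have "path (reversepath \<delta>)" "path_image (reversepath \<delta>) \<subseteq> U" using \<delta> by auto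
    note fp = fpath[OF this]
    obtain r where r: "path r" "path_image r \<subseteq> C" "pathstart r = v"
      "\<And>t. t \<in> {0..1} \<Longrightarrow> p (r t) = (f \<circ> reversepath \<delta>) t"
      by (rule lifts_over_path[OF cov fp vC]) blast
    let ?l = "\<gamma> +++ reversepath \<delta>"
    have l: "path ?l" "path_image ?l \<subseteq> U" "pathstart ?l = z" "pathfinish ?l = z"
      using \<gamma> \<delta> by (auto simp: path_image_join)
    hence "homotopic_loops U ?l (\<lambda>_. z)" using z U(1)[unfolded simply_connected_def, rule_format, of ?l "\<lambda>_. z"]
      by (auto simp: path_def path_image_def pathstart_def pathfinish_def)
    hence "homotopic_loops S (f \<circ> ?l) (f \<circ> (\<lambda>_. z))"
      by (rule homotopic_loops_continuous_image) (use f in auto)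
    hence hom: "homotopic_loops S (f \<circ> ?l) (\<lambda>_. f z)" by (simp add: o_def)
    \<comment> \<open>Here \<open>r\<close> continues \<open>k\<close> over the reversed second
      path. As the joined lift closes up, \<open>r\<close> reversed starts at \<open>a\<close> and
      lies over the same path as \<open>m\<close>, so the two have the same end.\<close>
    have "pathfinish (k +++ r) = pathstart (k +++ r)"
    proof (rule lift_of_null_homotopic_loop_closed[OF cov hom])
      show "path (k +++ r)" "path_image (k +++ r) \<subseteq> C" using k r by (auto simp: path_image_join)
      fix t :: real assume "t \<in> {0..1}"
      thus "p ((k +++ r) t) = (f \<circ> ?l) t" 
        using k(5)[of "2*t"] r(4)[of "2*t-1"] by (auto simp: joinpaths_def reversepath_def)
    qed
    hence "pathfinish r = a" using k(3) by simp
    have rr: "path (reversepath r)" "path_image (reversepath r) \<subseteq> C" using r by auto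
    have "p (reversepath r t) = p (m t)" if "t \<in> {0..1}" for t
      using that r(4)[of "1 - t"] m(5)[of t] by (simp add: reversepath_def)
    moreover have "reversepath r 0 = m 0"
      using \<open>pathfinish r = a\<close> m(3) by (simp add: reversepath_def pathstart_def pathfinish_def)
    ultimately have "reversepath r 1 = m 1"
      using rr m(1,2) covering_space_lift_unique_general[OF cov, of "{0..1}" "reversepath r" m 0 1]
      unfolding path_def path_image_def by (simp add: image_subset_iff_funcset)
    thus "v = w" using r(3) m(4) by (simp add: reversepath_def pathstart_def pathfinish_def)
  qed
  define g where "g y = (THE w. E y w)" for y
  have Eg: "E y (g y)" if "y \<in> U" for y
    unfolding g_def using ex[OF that] uniq by (metis theI)
  have gE: "g y = w" if "E y w" for y w unfolding g_def using that uniq by blast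
  have g: "g y \<in> C" "p (g y) = f y" if y: "y \<in> U" for y
  proof -
    obtain \<gamma> k where "pathfinish \<gamma> = y" and C: "path_image k \<subseteq> C" "pathfinish k = g y"
      and k: "\<forall>t\<in>{0..1}. p (k t) = f (\<gamma> t)"
      using Eg[OF y] unfolding E_def by blast
    thus "p (g y) = f y" using bspec[OF k, of 1] by (simp add: pathfinish_def)
    show "g y \<in> C" using C pathfinish_in_path_image[of k] by (simp add: subset_eq)
  qed
  have "E z a" unfolding E_def
    by (intro exI[of _ "\<lambda>_. z"] exI[of _ "\<lambda>_. a"])
      (use z a in \<open>auto simp: path_def path_image_def pathstart_def pathfinish_def\<close>)
  hence "g z = a" by (rule gE)
  moreover have "continuous_on U g"
    unfolding continuous_on_def
  proof (rule ballI)
    fix y assume y: "y \<in> U"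
    obtain V \<V> u q where V: "p (g y) \<in> V" "openin (top_of_set S) V" "\<Union>\<V> = C \<inter> p -` V"
      "u \<in> \<V>" "g y \<in> u" "homeomorphism u V p q"
      by (rule covering_space_sheet[OF cov g(1)[OF y]]) blast
    have "openin (top_of_set U) (U \<inter> f -` V)"
      by (rule continuous_openin_preimage[OF f V(2)])
    moreover have "y \<in> U \<inter> f -` V" using y V(1) g(2)[OF y] by simp
    ultimately obtain A B where AB: "openin (top_of_set U) A" "path_connected B" "y \<in> A" "A \<subseteq> B" "B \<subseteq> U \<inter> f -` V"
      using locallyE[OF U(2)] by (metis (no_types, lifting))
    have uC: "u \<subseteq> C" using V(3,4) by blast
    \<comment> \<open>A path to \<open>y\<close> is prolonged inside \<open>B\<close> to
      \<open>x\<close>; since \<open>f\<close> maps \<open>B\<close> into the evenly covered set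
      \<open>V\<close>, the prolongation lifts by \<open>q\<close> within the sheet.\<close>
    have gq: "g x = q (f x)" if x: "x \<in> B" for x
    proof -
      obtain \<gamma> k where \<gamma>: "path \<gamma>" "path_image \<gamma> \<subseteq> U" "pathstart \<gamma> = z" "pathfinish \<gamma> = y"
        and k: "path k" "path_image k \<subseteq> C" "pathstart k = a" "pathfinish k = g y" "\<And>t. t \<in> {0..1} \<Longrightarrow> p (k t) = f (\<gamma> t)"
        using Eg[OF y] unfolding E_def by blast
      obtain \<eta> where \<eta>: "path \<eta>" "path_image \<eta> \<subseteq> B" "pathstart \<eta> = y" "pathfinish \<eta> = x"
        using AB x path_connected_def[of B] by (meson subsetD)
      have \<eta>B: "\<eta> t \<in> B" if "t \<in> {0..1}" for t using \<eta> that by (auto simp: path_image_def)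
      have \<eta>': "path_image \<eta> \<subseteq> U" using \<eta> AB by blast
      have f\<eta>: "f (\<eta> t) \<in> V" if "t \<in> {0..1}" for t using \<eta>B[OF that] AB(5) by blast
      have "continuous_on (path_image (f \<circ> \<eta>)) q"
        by (rule continuous_on_subset[OF homeomorphism_cont2[OF V(6)]])
          (use f\<eta> in \<open>auto simp: path_image_def\<close>)
      hence "path (q \<circ> (f \<circ> \<eta>))"
        by (rule path_continuous_image[OF fpath(1)[OF \<eta>(1) \<eta>']])
      moreover have "q (f (\<eta> t)) \<in> C" if "t \<in> {0..1}" for t
        using f\<eta>[OF that] uC homeomorphism_image2[OF V(6)] by blast
      hence "path_image (q \<circ> (f \<circ> \<eta>)) \<subseteq> C" by (auto simp: path_image_def)
      moreover have "pathstart (q \<circ> (f \<circ> \<eta>)) = g y"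
        using \<eta>(3) g(2)[OF y] homeomorphism_apply1[OF V(6) V(5)] by (simp add: pathstart_def)
      moreover have "p (q (f (\<eta> t))) = f (\<eta> t)" if "t \<in> {0..1}" for t
        by (rule homeomorphism_apply2[OF V(6) f\<eta>[OF that]])
      moreover have "pathfinish (q \<circ> (f \<circ> \<eta>)) = q (f x)"
        using \<eta>(4) by (simp add: pathfinish_def)
      moreover define m where "m = q \<circ> (f \<circ> \<eta>)"
      ultimately have m: "path m" "path_image m \<subseteq> C" "pathstart m = g y" "pathfinish m = q (f x)"
        "\<And>t. t \<in> {0..1} \<Longrightarrow> p (m t) = f (\<eta> t)" by simp_all
      have "p ((k +++ m) t) = f ((\<gamma> +++ \<eta>) t)" if "t \<in> {0..1}" for t
        using that k(5)[of "2*t"] m(5)[of "2*t-1"] by (simp add: joinpaths_def)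
      moreover have "path (\<gamma> +++ \<eta>)" "path_image (\<gamma> +++ \<eta>) \<subseteq> U" "path (k +++ m)" "path_image (k +++ m) \<subseteq> C"
        using \<gamma> k(1-4) \<eta> \<eta>' m(1-4) by (simp_all add: path_image_join)
      ultimately have "E x (q (f x))" unfolding E_def
        using \<gamma>(3) \<eta>(4) k(3) m(4) by (intro exI[of _ "\<gamma> +++ \<eta>"] exI[of _ "k +++ m"]) simp
      thus ?thesis by (rule gE)
    qed
    have "continuous_on A (\<lambda>x. q (f x))"
      by (rule continuous_on_compose2[OF homeomorphism_cont2[OF V(6)] continuous_on_subset[OF f(1)]])
        (use AB in auto)
    hence "continuous_on A g" by (rule continuous_on_eq) (use gq AB in auto)
    moreover obtain G where G: "open G" "A = U \<inter> G" using AB(1) by (auto simp: openin_open)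
    have "at y within A = at y within U"
      by (rule at_within_nhd[of y G]) (use G AB(3) in auto)
    ultimately show "(g \<longlongrightarrow> g y) (at y within U)"
      using AB(3) by (metis continuous_on_def)
  qed
  moreover have "g \<in> U \<rightarrow> C" using g(1) by blast
  ultimately show thesis using that[of g] g(2) by blast
qed

text \<open>The lifts of \<open>g\<close> and of its inverse are normalised by
  \<open>x \<mapsto> a\<close> and \<open>a \<mapsto> x\<close>. Both composites are then lifts of
  \<open>p\<close> through \<open>p\<close> with a fixed point, hence identities.\<close>

lemma homeomorphism_lift_to_universal_cover:
  fixes p :: "'a::topological_space \<Rightarrow> 'b::topological_space"
  assumes cov: "covering_space C p S" and C: "simply_connected C" "C \<noteq> {}"
    and S: "locally path_connected S" and gh: "homeomorphism S S g h"
  obtains T T' where "homeomorphism C C T T'" "\<And>x. x \<in> C \<Longrightarrow> p (T x) = g (p x)"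
proof -
  have lpc: "locally path_connected C" by (rule locally_path_connected_covering[OF cov S])
  have con: "connected C"
    by (rule path_connected_imp_connected[OF simply_connected_imp_path_connected_general[OF C(1)]])
  have pC: "p ` C = S" "continuous_on C p" using cov by (auto simp: covering_space_def)
  have pS: "p x \<in> S" if "x \<in> C" for x using pC that by blast
  have g: "g ` S = S" "continuous_on S g" and h: "h ` S = S" "continuous_on S h"
    and hg: "\<And>x. x \<in> S \<Longrightarrow> h (g x) = x" and gh: "\<And>x. x \<in> S \<Longrightarrow> g (h x) = x"
    using gh by (auto simp: homeomorphism_def)
  have comp: "continuous_on C (\<lambda>x. k (p x))" "(\<lambda>x. k (p x)) \<in> C \<rightarrow> S" if "continuous_on S k" "k ` S = S" for k
    using continuous_on_compose2[OF that(1) pC(2)] pC(1) that(2) by auto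
  obtain x where x: "x \<in> C" using C by blast
  have "g (p x) \<in> p ` C" using pS[OF x] g(1) pC(1) by blast
  then obtain a where a: "a \<in> C" "p a = g (p x)" by auto
  obtain T where T: "continuous_on C T" "T \<in> C \<rightarrow> C" "\<And>y. y \<in> C \<Longrightarrow> p (T y) = g (p y)" "T x = a"
    by (rule simply_connected_lift_exists[OF cov C(1) lpc comp[OF g(2,1)] x a]) (rule that)
  have "p x = h (p a)" using hg[OF pS[OF x]] a(2) by simp
  then obtain T' where T': "continuous_on C T'" "T' \<in> C \<rightarrow> C" "\<And>y. y \<in> C \<Longrightarrow> p (T' y) = h (p y)" "T' a = x"
    by (rule simply_connected_lift_exists[OF cov C(1) lpc comp[OF h(2,1)] a(1) x]) (rule that)
  have TC: "T y \<in> C" and T'C: "T' y \<in> C" if "y \<in> C" for y using T(2) T'(2) that by auto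
  have cc: "continuous_on C (\<lambda>y. T' (T y))" "continuous_on C (\<lambda>y. T (T' y))"
    by (rule continuous_on_compose2[OF T'(1) T(1)], use TC in blast,
        rule continuous_on_compose2[OF T(1) T'(1)], use T'C in blast)
  have T'T: "T' (T y) = y" if "y \<in> C" for y
  proof (rule covering_space_lift_unique_general[OF cov con cc(1) _ continuous_on_id _ _ x _ that])
    show "(\<lambda>y. T' (T y)) \<in> C \<rightarrow> C" "(\<lambda>y. y) \<in> C \<rightarrow> C" using TC T'C by auto
    show "p (T' (T v)) = p v" if "v \<in> C" for v
      using T'(3)[OF TC[OF that]] T(3)[OF that] hg[OF pS[OF that]] by simp
    show "T' (T x) = x" using T(4) T'(4) by simp
  qed
  have TT': "T (T' y) = y" if "y \<in> C" for y
  proof (rule covering_space_lift_unique_general[OF cov con cc(2) _ continuous_on_id _ _ a(1) _ that])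
    show "(\<lambda>y. T (T' y)) \<in> C \<rightarrow> C" "(\<lambda>y. y) \<in> C \<rightarrow> C" using TC T'C by auto
    show "p (T (T' v)) = p v" if "v \<in> C" for v
      using T(3)[OF T'C[OF that]] T'(3)[OF that] gh[OF pS[OF that]] by simp
    show "T (T' a) = a" using T(4) T'(4) by simp
  qed
  have "T ` C = C" "T' ` C = C" using TC T'C T'T TT' by (metis image_eqI subsetI subset_antisym image_subsetI)+
  hence "homeomorphism C C T T'" unfolding homeomorphism_def using T(1) T'(1) T'T TT' by blast
  thus thesis using that T(3) by blast
qed

section \<open>The regular part of the superelliptic curve\<close>

lemma continuous_root_on_ball:
  fixes f :: "'a::real_normed_vector \<Rightarrow> complex"
  assumes "continuous_on (ball a r) f" "\<And>x. x \<in> ball a r \<Longrightarrow> f x \<noteq> 0" "n > 0"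
  obtains g where "continuous_on (ball a r) g" "\<And>x. x \<in> ball a r \<Longrightarrow> g x ^ n = f x"
proof -
  obtain L where L: "continuous_on (ball a r) L" "\<And>x. x \<in> ball a r \<Longrightarrow> f x = exp (L x)"
    using continuous_logarithm_on_ball[OF assms(1,2)] by blast
  show thesis
  proof (rule that)
    show "continuous_on (ball a r) (\<lambda>x. exp (L x / of_nat n))"
      using L(1) assms(3) by (intro continuous_intros) auto
    show "exp (L x / of_nat n) ^ n = f x" if "x \<in> ball a r" for x
      using L(2)[OF that] assms(3) by (simp flip: exp_of_nat_mult)
  qed
qed

text \<open>
  Along a small circle, \<open>P / v\<^sup>d\<close> with \<open>v\<^sup>n = u\<close> is an \<open>n\<close>-th root of \<open>(x - a)\<^sup>d\<close>; it returns
  to its initial value only if \<open>n\<close> divides \<open>d\<close>.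
\<close>

lemma dvd_if_root_near_simple_zero:
  fixes P u :: "complex \<Rightarrow> complex"
  assumes r: "r > 0" and n: "n > 0" and P: "continuous_on (ball a r - {a}) P"
    and u: "continuous_on (ball a r) u" "\<And>x. x \<in> ball a r \<Longrightarrow> u x \<noteq> 0"
    and eq: "\<And>x. x \<in> ball a r - {a} \<Longrightarrow> P x ^ n = ((x - a) * u x) ^ d"
  shows "n dvd d"
proof -
  obtain v where v: "continuous_on (ball a r) v" "\<And>x. x \<in> ball a r \<Longrightarrow> v x ^ n = u x"
    using continuous_root_on_ball[OF u n] by blast
  define \<rho> where "\<rho> = complex_of_real (r / 2)"
  define c where "c t = a + \<rho> * exp (\<i> * of_real t)" for t
  have \<rho>: "\<rho> \<noteq> 0" "norm \<rho> < r" using r by (auto simp: \<rho>_def norm_divide)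
  have c: "c t \<in> ball a r - {a}" "c t - a = \<rho> * exp (\<i> * of_real t)" for t
    using \<rho> by (auto simp: c_def dist_norm norm_mult)
  have cc: "continuous_on {0..2*pi} c" unfolding c_def by (intro continuous_intros)
  \<comment> \<open>The exponential removes the continuous branch of the n-th root of
    \<open>exp (\<i> * of_real t) ^ d\<close>. So \<open>Q\<close> takes values among the finitely
    many n-th roots of \<open>\<rho> ^ d\<close> and is constant, while after a full turn only this
    exponential can have changed.\<close>
  define Q where "Q t = P (c t) / v (c t) ^ d * exp (- (\<i> * of_nat d * of_real t / of_nat n))" for t
  have v0: "v (c t) \<noteq> 0" for t
    using v(2)[of "c t"] u(2)[of "c t"] c(1)[of t] n by (auto simp: power_0_left)
  have Q: "Q t ^ n = \<rho> ^ d" for t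
  proof -
    have "(v (c t) ^ d) ^ n = (v (c t) ^ n) ^ d" by (simp add: mult.commute flip: power_mult)
    hence "(v (c t) ^ d) ^ n = u (c t) ^ d" using v(2)[of "c t"] c(1)[of t] by simp
    moreover have "P (c t) ^ n = (\<rho> * exp (\<i> * of_real t)) ^ d * u (c t) ^ d"
      using eq[OF c(1)] c(2) by (simp add: power_mult_distrib)
    moreover have "exp (- (\<i> * of_nat d * of_real t / of_nat n)) ^ n = exp (- (\<i> * of_real t)) ^ d"
      using n by (simp add: mult_ac flip: exp_of_nat_mult)
    ultimately have "Q t ^ n = (\<rho> * exp (\<i> * of_real t)) ^ d * u (c t) ^ d / u (c t) ^ d * exp (- (\<i> * of_real t)) ^ d"
      unfolding Q_def power_mult_distrib power_divide by simp
    also have "\<dots> = (\<rho> * exp (\<i> * of_real t)) ^ d * exp (- (\<i> * of_real t)) ^ d"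
      using u(2)[of "c t"] c(1)[of t] by simp
    also have "\<dots> = \<rho> ^ d" by (simp add: exp_minus field_simps flip: power_mult_distrib)
    finally show ?thesis .
  qed
  have "continuous_on {0..2*pi} Q"
    unfolding Q_def
  proof (intro continuous_intros)
    show "continuous_on {0..2*pi} (\<lambda>t. P (c t))"
      by (rule continuous_on_compose2[OF P cc]) (use c in blast)
    show "continuous_on {0..2*pi} (\<lambda>t. v (c t))"
      by (rule continuous_on_compose2[OF v(1) cc]) (use c in blast)
  qed (use n v0 in auto)
  moreover have "finite (Q ` {0..2*pi})"
    by (rule finite_subset[of _ "{w. w ^ n = \<rho> ^ d}"]) (use Q n in \<open>auto intro: finite_nth_roots\<close>)
  ultimately have "Q constant_on {0..2*pi}"
    by (intro continuous_finite_range_constant) auto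
  then obtain k where "\<And>t. t \<in> {0..2*pi} \<Longrightarrow> Q t = k" unfolding constant_on_def by blast
  hence Q2: "Q (2*pi) = Q 0" by simp
  have c2: "c (2*pi) = c 0" by (simp add: c_def exp_eq_polar)
  define F where "F = P (c 0) / v (c 0) ^ d"
  have "F \<noteq> 0"
  proof
    assume "F = 0"
    hence "Q 0 = 0" unfolding Q_def F_def by simp
    thus False using Q[of 0] \<rho>(1) n by (simp add: power_0_left)
  qed
  moreover have "F * exp (- (\<i> * of_nat d * of_real (2*pi) / of_nat n)) = F * 1"
    using Q2 unfolding Q_def c2 F_def[symmetric] by simp
  ultimately have "exp (- (\<i> * of_nat d * of_real (2*pi) / of_nat n)) = 1"
    by (simp only: mult_cancel_left simp_thms)
  then obtain m :: int where "- (real d * (2*pi) / real n) = of_int (2*m) * pi"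
    unfolding exp_eq_1 by (auto simp: Im_divide_of_nat)
  hence "pi * real d = pi * (- of_int m * real n)" using n by (simp add: field_simps)
  hence "real d = - of_int m * real n" by (simp only: mult_cancel_left pi_neq_zero simp_thms)
  hence "real_of_int (int d) = real_of_int (- m * int n)" by simp
  hence "int d = - m * int n" by (simp only: of_int_eq_iff)
  hence "int n dvd int d" by simp
  thus ?thesis by simp
qed

section \<open>Local branches, connectedness and charts of the curve\<close>

lemma local_root:
  fixes f :: "complex \<Rightarrow> complex"
  assumes D: "open D" and f: "continuous_on D f" "\<And>x. x \<in> D \<Longrightarrow> f x \<noteq> 0" and n: "n > 0" and x: "x \<in> D"
  obtains e g where "e > 0" "ball x e \<subseteq> D" "continuous_on (ball x e) g"
    "\<And>y. y \<in> ball x e \<Longrightarrow> g y ^ n = f y" "\<And>y. y \<in> ball x e \<Longrightarrow> g y \<noteq> 0"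
proof -
  obtain e where e: "e > 0" "ball x e \<subseteq> D" using D x openE by blast
  obtain g where g: "continuous_on (ball x e) g" "\<And>y. y \<in> ball x e \<Longrightarrow> g y ^ n = f y"
    using continuous_root_on_ball[of x e f n] f n e continuous_on_subset by (metis subsetD)
  have "g y \<noteq> 0" if "y \<in> ball x e" for y
    using g(2)[OF that] f(2) e(2) that n by (auto simp: power_0_left)
  thus thesis using that e g by blast
qed

text \<open>For a root of unity \<open>\<zeta>\<close> the section
  \<open>y \<mapsto> (y, g y * \<zeta>)\<close> has connected domain, so the clopen set
  \<open>Z\<close> contains all or none of it. Which multiples of \<open>g y\<close> lie in the
  fibre can therefore be read off at the centre \<open>x\<close>.\<close>

lemma fibre_near:
  fixes g :: "complex \<Rightarrow> complex"
  assumes Z: "openin (top_of_set R) Z" "closedin (top_of_set R) Z"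
    and R: "R = {(x, w). x \<in> D \<and> w ^ n = f x}"
    and e: "e > 0" "ball x e \<subseteq> D" and g: "continuous_on (ball x e) g"
      "\<And>y. y \<in> ball x e \<Longrightarrow> g y ^ n = f y" "\<And>y. y \<in> ball x e \<Longrightarrow> g y \<noteq> 0"
    and y: "y \<in> ball x e"
  shows "{w. (y, w) \<in> Z} = (\<lambda>\<zeta>. g y * \<zeta>) ` {\<zeta>. \<zeta> ^ n = 1 \<and> (x, g x * \<zeta>) \<in> Z}"
proof -
  have move: "(y, g y * \<zeta>) \<in> Z \<longleftrightarrow> (x, g x * \<zeta>) \<in> Z" if \<zeta>: "\<zeta> ^ n = 1" for \<zeta>
  proof -
    let ?s = "\<lambda>y. (y, g y * \<zeta>)" and ?B = "ball x e"
    have s: "continuous_on ?B ?s" using g(1) by (intro continuous_intros)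
    have sR: "?s \<in> ?B \<rightarrow> R" using e(2) g(2) \<zeta> unfolding R by (auto simp: power_mult_distrib)
    have "openin (top_of_set ?B) (?B \<inter> ?s -` Z)" by (rule continuous_openin_preimage[OF s sR Z(1)])
    moreover have "closedin (top_of_set ?B) (?B \<inter> ?s -` Z)"
      by (rule continuous_closedin_preimage_gen[OF s sR Z(2)])
    moreover have "connected ?B" by simp
    ultimately have "?B \<inter> ?s -` Z = {} \<or> ?B \<inter> ?s -` Z = ?B"
      unfolding connected_clopen by blast
    moreover have "y \<in> W \<longleftrightarrow> x \<in> W" if "W = {} \<or> W = ?B" for W
      using that y e(1) by (elim disjE) simp_all
    ultimately have "y \<in> ?B \<inter> ?s -` Z \<longleftrightarrow> x \<in> ?B \<inter> ?s -` Z" by blast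
    thus ?thesis using y e(1) by simp
  qed
  show ?thesis
  proof (intro equalityI subsetI)
    fix w assume "w \<in> {w. (y, w) \<in> Z}"
    hence w: "(y, w) \<in> Z" by simp
    hence "w ^ n = g y ^ n" using openin_imp_subset[OF Z(1)] g(2)[OF y] unfolding R by auto
    hence "(w / g y) ^ n = 1" using g(3)[OF y] by (simp add: power_divide)
    moreover have "w = g y * (w / g y)" using g(3)[OF y] by simp
    ultimately show "w \<in> (\<lambda>\<zeta>. g y * \<zeta>) ` {\<zeta>. \<zeta> ^ n = 1 \<and> (x, g x * \<zeta>) \<in> Z}"
      using w move[of "w / g y"] by (intro image_eqI[of _ _ "w / g y"]) auto
  next
    fix w assume "w \<in> (\<lambda>\<zeta>. g y * \<zeta>) ` {\<zeta>. \<zeta> ^ n = 1 \<and> (x, g x * \<zeta>) \<in> Z}"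
    then obtain \<zeta> where "w = g y * \<zeta>" "\<zeta> ^ n = 1" "(x, g x * \<zeta>) \<in> Z" by blast
    thus "w \<in> {w. (y, w) \<in> Z}" using move[of \<zeta>] by simp
  qed
qed

text \<open>
  The product of the fibre of a clopen set over \<open>x\<close> is a continuous function whose \<open>n\<close>-th power is
  \<open>f\<^sup>d\<close>, where \<open>d\<close> is the size of the fibres; at a simple zero of \<open>f\<close> this forces \<open>n\<close> to divide \<open>d\<close>.
\<close>

lemma connected_superelliptic:
  fixes f :: "complex \<Rightarrow> complex"
  assumes D: "open D" "connected D" and f: "continuous_on D f" "\<And>x. x \<in> D \<Longrightarrow> f x \<noteq> 0" and n: "n > 0"
    and r: "r > 0" "ball a r - {a} \<subseteq> D"
    and u: "continuous_on (ball a r) u" "\<And>x. x \<in> ball a r \<Longrightarrow> u x \<noteq> 0"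
      "\<And>x. x \<in> ball a r \<Longrightarrow> f x = (x - a) * u x"
  shows "connected {(x, w). x \<in> D \<and> w ^ n = f x}" (is "connected ?R")
  unfolding connected_clopen
proof (intro allI impI)
  fix Z assume Z: "openin (top_of_set ?R) Z \<and> closedin (top_of_set ?R) Z"
  have ZR: "Z \<subseteq> ?R" using Z openin_imp_subset by blast
  define E where "E x = {w. (x, w) \<in> Z}" for x
  have EZ: "(x, w) \<in> Z \<longleftrightarrow> w \<in> E x" for x w by (simp add: E_def)
  have Eroots: "E x \<subseteq> {w. w ^ n = f x}" for x using ZR by (auto simp: E_def)
  \<comment> \<open>\<open>J\<close> is the set of roots of unity selected at \<open>x\<close>. It
    does not vary with \<open>y\<close>, which gives both the constancy of the fibre size and the
    continuity of the fibre product.\<close>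
  have near: "\<exists>e g J. e > 0 \<and> ball x e \<subseteq> D \<and> continuous_on (ball x e) g \<and>
      (\<forall>y\<in>ball x e. card (E y) = card J \<and> \<Prod>(E y) = g y ^ card J * \<Prod>J)" if x: "x \<in> D" for x
  proof -
    obtain e g where e: "e > 0" "ball x e \<subseteq> D" and g: "continuous_on (ball x e) g"
      "\<And>y. y \<in> ball x e \<Longrightarrow> g y ^ n = f y" "\<And>y. y \<in> ball x e \<Longrightarrow> g y \<noteq> 0"
      by (rule local_root[OF D(1) f n x]) (assumption, rule that)
    let ?J = "{\<zeta>. \<zeta> ^ n = 1 \<and> (x, g x * \<zeta>) \<in> Z}"
    have "card (E y) = card ?J \<and> \<Prod>(E y) = g y ^ card ?J * \<Prod>?J" if y: "y \<in> ball x e" for y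
    proof -
      have E: "E y = (\<lambda>\<zeta>. g y * \<zeta>) ` ?J"
        unfolding E_def by (rule fibre_near[OF conjunct1[OF Z] conjunct2[OF Z] refl e g y])
      have inj: "inj_on (\<lambda>\<zeta>. g y * \<zeta>) ?J" using g(3)[OF y] by (auto simp: inj_on_def)
      show ?thesis unfolding E using card_image[OF inj] by (simp add: prod.reindex[OF inj] prod.distrib)
    qed
    thus ?thesis using e g(1) by blast
  qed
  have "(\<lambda>x. card (E x)) constant_on D"
  proof (rule locally_constant_imp_constant[OF D(2)])
    fix x assume x: "x \<in> D"
    obtain e g J where e: "e > 0" "ball x e \<subseteq> D"
      and J: "\<forall>y\<in>ball x e. card (E y) = card J \<and> \<Prod>(E y) = g y ^ card J * \<Prod>J"
      using near[OF x] by blast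
    have "openin (top_of_set D) (ball x e)" using e D by (simp add: openin_open_eq)
    moreover have "card (E y) = card (E x)" if "y \<in> ball x e" for y using J e(1) that by simp
    ultimately show "\<exists>T. openin (top_of_set D) T \<and> x \<in> T \<and> (\<forall>y\<in>T. card (E y) = card (E x))"
      using e(1) by (meson centre_in_ball)
  qed
  then obtain d where d: "\<And>x. x \<in> D \<Longrightarrow> card (E x) = d" unfolding constant_on_def by blast
  define P where "P x = \<Prod>(E x)" for x
  have P: "continuous_on D P"
    unfolding continuous_on_eq_continuous_at[OF D(1)]
  proof
    fix x assume x: "x \<in> D"
    obtain e g J where e: "e > 0" and g: "continuous_on (ball x e) g"
      and J: "\<forall>y\<in>ball x e. card (E y) = card J \<and> \<Prod>(E y) = g y ^ card J * \<Prod>J"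
      using near[OF x] by blast
    have "continuous_on (ball x e) (\<lambda>y. g y ^ card J * \<Prod>J)" by (intro continuous_intros g)
    hence "continuous_on (ball x e) P" by (rule continuous_on_eq) (use J in \<open>simp add: P_def\<close>)
    thus "isCont P x" using e by (simp add: continuous_on_eq_continuous_at)
  qed
  have Pn: "P x ^ n = f x ^ d" if "x \<in> D" for x
  proof -
    have "P x ^ n = (\<Prod>w\<in>E x. w ^ n)" unfolding P_def by (simp add: prod_power_distrib)
    also have "\<dots> = (\<Prod>w\<in>E x. f x)" using Eroots by (intro prod.cong) auto
    finally show ?thesis using d[OF that] by simp
  qed
  have "n dvd d"
  proof (rule dvd_if_root_near_simple_zero[OF r(1) n _ u(1,2)])
    show "continuous_on (ball a r - {a}) P" by (rule continuous_on_subset[OF P r(2)])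
    show "P x ^ n = ((x - a) * u x) ^ d" if "x \<in> ball a r - {a}" for x
      using Pn[of x] r(2) u(3)[of x] that by auto
  qed
  have roots: "finite {w. w ^ n = f x}" "card {w. w ^ n = f x} = n" if "x \<in> D" for x
    using card_nth_roots[of "f x" n] finite_nth_roots[of n "f x"] f(2)[OF that] n by auto
  show "Z = {} \<or> Z = ?R"
  \<comment> \<open>A fibre of the curve has exactly \<open>n\<close> points, so the only multiples
    of \<open>n\<close> available for \<open>d\<close> are 0 and \<open>n\<close>.\<close>
  proof (cases "d = 0")
    case True
    have "w \<notin> E x" if "x \<in> D" for x w
      using d[OF that] True finite_subset[OF Eroots roots(1)[OF that]] by auto
    thus ?thesis using ZR EZ by fast
  next
    case False
    have "E x = {w. w ^ n = f x}" if x: "x \<in> D" for x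
    proof (rule card_subset_eq[OF roots(1)[OF x] Eroots])
      have "card (E x) \<le> n" using card_mono[OF roots(1)[OF x] Eroots] roots(2)[OF x] by simp
      hence "d = n" using \<open>n dvd d\<close> False d[OF x] by (auto dest: dvd_imp_le)
      thus "card (E x) = card {w. w ^ n = f x}" using d[OF x] roots(2)[OF x] by simp
    qed
    hence "?R \<subseteq> Z" using EZ by auto
    thus ?thesis using ZR by blast
  qed
qed

text \<open>The chart domain is the graph of the branch \<open>h\<close> through
  \<open>(x, w)\<close>. On the curve \<open>v / h y\<close> is an n-th root of unity, so the open
  condition of avoiding the finite set \<open>A\<close> of roots other than 1 cuts out exactly this
  graph.\<close>

lemma superelliptic_chart:
  fixes f :: "complex \<Rightarrow> complex"
  assumes D: "open D" and f: "continuous_on D f" "\<And>x. x \<in> D \<Longrightarrow> f x \<noteq> 0" and n: "n > 0"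
    and Y: "Y = {(x, w). w ^ n = f x}" and x: "x \<in> D" "w ^ n = f x"
  shows "\<exists>U V s. openin (top_of_set Y) U \<and> (x, w) \<in> U \<and> U \<subseteq> D \<times> UNIV \<and> open V \<and> V \<subseteq> D \<and> homeomorphism U V fst s"
proof -
  obtain e g where e: "e > 0" "ball x e \<subseteq> D" and g: "continuous_on (ball x e) g"
      "\<And>y. y \<in> ball x e \<Longrightarrow> g y ^ n = f y" "\<And>y. y \<in> ball x e \<Longrightarrow> g y \<noteq> 0"
      by (rule local_root[OF D(1) f n x(1)]) (assumption, rule that)
  let ?B = "ball x e"
  define \<omega> where "\<omega> = w / g x"
  define h where "h y = g y * \<omega>" for y
  have xB: "x \<in> ?B" using e(1) by simp
  have w0: "w \<noteq> 0" using x f(2)[OF x(1)] n by (auto simp: power_0_left)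
  have \<omega>: "\<omega> ^ n = 1" "\<omega> \<noteq> 0" "g x * \<omega> = w"
    using x(2) g(2,3)[OF xB] f(2)[OF x(1)] w0 by (simp_all add: \<omega>_def power_divide)
  have h: "continuous_on ?B h" "\<And>y. y \<in> ?B \<Longrightarrow> h y ^ n = f y" "\<And>y. y \<in> ?B \<Longrightarrow> h y \<noteq> 0" "h x = w"
    unfolding h_def using g \<omega> by (simp_all add: continuous_on_mult_right power_mult_distrib)
  define A where "A = {\<zeta>::complex. \<zeta> ^ n = 1} - {1}"
  have "closed A" unfolding A_def using n by (intro finite_imp_closed finite_Diff finite_nth_roots) auto
  let ?k = "\<lambda>p. snd p / h (fst p)"
  let ?G = "(?B \<times> UNIV) \<inter> ?k -` (- A)"
  have "continuous_on (?B \<times> UNIV) ?k"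
  proof (intro continuous_intros)
    show "continuous_on (?B \<times> UNIV) (\<lambda>p. h (fst p))"
      by (rule continuous_on_compose2[OF h(1)]) (auto intro: continuous_intros)
  qed (use h(3) in auto)
  hence "open ?G"
    using \<open>closed A\<close> by (intro continuous_open_preimage) (auto simp: open_Times)
  hence oG: "openin (top_of_set Y) (Y \<inter> ?G)" by blast
  have YG: "Y \<inter> ?G = (\<lambda>y. (y, h y)) ` ?B"
  proof (intro equalityI subsetI)
    fix p assume p: "p \<in> Y \<inter> ?G"
    then obtain y v where yv: "p = (y, v)" "y \<in> ?B" "v ^ n = f y" "v / h y \<notin> A" unfolding Y by auto
    have "y \<in> D" using yv(2) e(2) by blast
    hence "(v / h y) ^ n = 1" using yv(3) h(2)[OF yv(2)] f(2) by (simp add: power_divide)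
    hence "v / h y = 1" using yv(4) by (simp add: A_def)
    hence "v = h y" using h(3)[OF yv(2)] by simp
    thus "p \<in> (\<lambda>y. (y, h y)) ` ?B" using yv by blast
  next
    fix p assume "p \<in> (\<lambda>y. (y, h y)) ` ?B"
    then obtain y where y: "p = (y, h y)" "y \<in> ?B" by blast
    thus "p \<in> Y \<inter> ?G" using h(2,3)[OF y(2)] by (simp add: Y A_def)
  qed
  have "homeomorphism (Y \<inter> ?G) ?B fst (\<lambda>y. (y, h y))"
    unfolding YG homeomorphism_def
    using h(1) by (auto intro!: continuous_intros simp: image_image)
  moreover have "(x, w) \<in> Y \<inter> ?G" unfolding YG using xB h(4) by force
  moreover have "Y \<inter> ?G \<subseteq> D \<times> UNIV" using e(2) by auto
  ultimately show ?thesis using oG e(2) open_ball[of x e] by blast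
qed

section \<open>Weierstrass maps have simple zeros\<close>

lemma weierstrass_term_eq_0_iff: "weierstrass_term z d k x = 0 \<longleftrightarrow> z k \<noteq> 0 \<and> x = z k"
  by (auto simp: weierstrass_term_def)

lemma continuous_on_weierstrass_term: "continuous_on A (weierstrass_term z d k)"
proof (cases "z k = 0")
  case True
  thus ?thesis unfolding weierstrass_term_def by simp
next
  case False
  thus ?thesis unfolding weierstrass_term_def by (auto intro!: continuous_intros)
qed

text \<open>Connects the tails in \<open>compactly_convergent_prod\<close> with the library notion
  of infinite product, which asks for a nonzero limit of a tail. A vanishing factor beyond
  \<open>M\<close> would make the tail products eventually 0, contrary to
  \<open>g \<noteq> 0\<close>.\<close>

lemma prodinf_eq_prod_times_tail:
  fixes F :: "nat \<Rightarrow> complex"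
  assumes lim: "(\<lambda>N. \<Prod>k=M..<N. F k) \<longlonglongrightarrow> g" and g: "g \<noteq> 0"
  shows "(\<Prod>k. F k) = (\<Prod>k<M. F k) * g" and "k \<ge> M \<Longrightarrow> F k \<noteq> 0"
proof -
  \<comment> \<open>\<open>raw_has_prod\<close> multiplies over \<open>i \<le> n\<close>, that is,
    \<open>n + 1\<close> factors from \<open>M\<close> on; hence the \<open>Suc\<close>.\<close>
  have "(\<lambda>n. \<Prod>k=M..<Suc n + M. F k) \<longlonglongrightarrow> g"
    using LIMSEQ_ignore_initial_segment[OF lim, of "Suc M"] by simp
  moreover have "(\<Prod>k=M..<Suc n + M. F k) = (\<Prod>i\<le>n. F (i + M))" for n
    using prod.shift_bounds_nat_ivl[of F 0 M "Suc n"] by (simp add: atLeast0LessThan lessThan_Suc_atMost)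
  ultimately have "raw_has_prod F M g" unfolding raw_has_prod_def using g by simp
  hence "convergent_prod F" unfolding convergent_prod_def by blast
  hence 1: "(\<lambda>n. \<Prod>i\<le>n. F i) \<longlonglongrightarrow> (\<Prod>k. F k)" by (rule convergent_prod_LIMSEQ)
  have "(\<lambda>n. (\<Prod>k<M. F k) * (\<Prod>k=M..<Suc n. F k)) \<longlonglongrightarrow> (\<Prod>k<M. F k) * g"
    by (intro tendsto_intros filterlim_compose[OF lim filterlim_Suc])
  moreover have "eventually (\<lambda>n. (\<Prod>k<M. F k) * (\<Prod>k=M..<Suc n. F k) = (\<Prod>i\<le>n. F i)) sequentially"
    using eventually_ge_at_top[of M]
  proof eventually_elim
    case (elim n)
    thus ?case using prod.atLeastLessThan_concat[of 0 M "Suc n" F]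
      by (simp add: atLeast0LessThan lessThan_Suc_atMost)
  qed
  ultimately have "(\<lambda>n. \<Prod>i\<le>n. F i) \<longlonglongrightarrow> (\<Prod>k<M. F k) * g" by (rule Lim_transform_eventually)
  thus "(\<Prod>k. F k) = (\<Prod>k<M. F k) * g" using 1 LIMSEQ_unique by blast
  show "F k \<noteq> 0" if k: "k \<ge> M"
  proof
    assume 0: "F k = 0"
    have "eventually (\<lambda>N. (\<Prod>k=M..<N. F k) = 0) sequentially"
      using eventually_gt_at_top[of k]
      by eventually_elim (use 0 k in \<open>auto intro: bexI[of _ k]\<close>)
    hence "(\<lambda>N. \<Prod>k=M..<N. F k) \<longlonglongrightarrow> 0" by (rule tendsto_eventually)
    thus False using lim g LIMSEQ_unique by blast
  qed
qed

text \<open>On a compact set the tail of the product is absorbed, with the zero-free entire factor,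
  into one continuous zero-free \<open>h\<close>; the zeros of \<open>f\<close> there are decided by
  finitely many factors.\<close>

lemma weierstrass_map_on_compact:
  assumes "weierstrass_map z f" "compact K"
  obtains M d h where "continuous_on K h" "\<And>x. x \<in> K \<Longrightarrow> h x \<noteq> 0"
    "\<And>x. x \<in> K \<Longrightarrow> f x = h x * x ^ (if 0 \<in> range z then 1 else 0) * (\<Prod>k<M. weierstrass_term z d k x)"
    "\<And>x k. x \<in> K \<Longrightarrow> k \<ge> M \<Longrightarrow> weierstrass_term z d k x \<noteq> 0"
proof -
  obtain h d where h: "h holomorphic_on UNIV" "\<And>x. h x \<noteq> 0"
    and conv: "compactly_convergent_prod (weierstrass_term z d)"
    and f: "\<And>x. f x = h x * x ^ (if 0 \<in> range z then 1 else 0) * (\<Prod>k. weierstrass_term z d k x)"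
    using assms(1) unfolding weierstrass_map_def by auto
  obtain M g where g: "uniform_limit K (\<lambda>N x. \<Prod>k=M..<N. weierstrass_term z d k x) g sequentially"
    "\<And>x. x \<in> K \<Longrightarrow> g x \<noteq> 0"
    using conv assms(2) unfolding compactly_convergent_prod_def by blast
  have lim: "(\<lambda>N. \<Prod>k=M..<N. weierstrass_term z d k x) \<longlonglongrightarrow> g x" if "x \<in> K" for x
    using tendsto_uniform_limitI[OF g(1) that] .
  have "continuous_on K g"
  proof (rule uniform_limit_theorem[OF _ g(1)])
    show "\<forall>\<^sub>F N in sequentially. continuous_on K (\<lambda>x. \<Prod>k=M..<N. weierstrass_term z d k x)"
      by (intro always_eventually allI continuous_intros continuous_on_weierstrass_term)
  qed simp
  moreover have "continuous_on K h" using h(1) holomorphic_on_imp_continuous_on holomorphic_on_subset by blast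
  ultimately have "continuous_on K (\<lambda>x. h x * g x)" by (intro continuous_intros)
  thus thesis
  proof (rule that)
    show "h x * g x \<noteq> 0" if "x \<in> K" for x using h(2) g(2)[OF that] by simp
    show "f x = h x * g x * x ^ (if 0 \<in> range z then 1 else 0) * (\<Prod>k<M. weierstrass_term z d k x)" if "x \<in> K" for x
      unfolding f prodinf_eq_prod_times_tail(1)[OF lim[OF that] g(2)[OF that]] by (simp add: mult_ac)
    show "weierstrass_term z d k x \<noteq> 0" if "x \<in> K" "k \<ge> M" for x k
      by (rule prodinf_eq_prod_times_tail(2)[OF lim[OF that(1)] g(2)[OF that(1)] that(2)])
  qed
qed

lemma continuous_weierstrass_map:
  assumes "weierstrass_map z f"
  shows "continuous_on UNIV f"
  unfolding continuous_on_eq_continuous_at[OF open_UNIV]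
proof
  fix x :: complex
  obtain M d h where h: "continuous_on (cball x 1) h"
    and f: "\<And>y. y \<in> cball x 1 \<Longrightarrow> f y = h y * y ^ (if 0 \<in> range z then 1 else 0) * (\<Prod>k<M. weierstrass_term z d k y)"
    by (rule weierstrass_map_on_compact[OF assms compact_cball[of x 1]]) (rule that)
  have "continuous_on (cball x 1) (\<lambda>y. h y * y ^ (if 0 \<in> range z then 1 else 0) * (\<Prod>k<M. weierstrass_term z d k y))"
    by (intro continuous_intros h continuous_on_weierstrass_term)
  hence "continuous_on (cball x 1) f" by (rule continuous_on_eq) (rule f[symmetric])
  thus "isCont f x" by (rule continuous_on_interior) simp
qed

lemma weierstrass_map_eq_0_iff:
  assumes "weierstrass_map z f"
  shows "f x = 0 \<longleftrightarrow> x \<in> range z"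
proof -
  obtain M d h where h: "h x \<noteq> 0"
    and f: "f x = h x * x ^ (if 0 \<in> range z then 1 else 0) * (\<Prod>k<M. weierstrass_term z d k x)"
    and tail: "\<And>k. k \<ge> M \<Longrightarrow> weierstrass_term z d k x \<noteq> 0"
    by (rule weierstrass_map_on_compact[OF assms compact_sing[of x]]) blast
  have "x \<in> range z" if "f x = 0"
  proof -
    have "x = 0 \<and> 0 \<in> range z \<or> (\<exists>k<M. weierstrass_term z d k x = 0)"
      using that h unfolding f by (auto split: if_splits)
    thus ?thesis unfolding weierstrass_term_eq_0_iff by auto
  qed
  moreover have "f x = 0" if k: "x = z k" for k
  proof (cases "x = 0")
    case True
    hence "0 \<in> range z" using k by (metis rangeI)
    thus ?thesis unfolding f by (simp add: True)
  next
    case False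
    hence "weierstrass_term z d k x = 0" using k by (simp add: weierstrass_term_eq_0_iff)
    moreover from this have "k < M" using tail[of k] by force
    ultimately have "(\<Prod>k<M. weierstrass_term z d k x) = 0" by (intro prod_zero) auto
    thus ?thesis unfolding f by simp
  qed
  ultimately show ?thesis by blast
qed

text \<open>By injectivity, the factor of index \<open>j\<close> alone vanishes at
  \<open>z j\<close>, and it splits off \<open>x - z j\<close>. A puncture away from the origin is
  taken because a zero at 0 sits in the power of \<open>x\<close> and not in a Weierstrass
  factor.\<close>

lemma weierstrass_map_simple_zero:
  assumes f: "weierstrass_map z f" and z: "inj z" "z j \<noteq> 0"
  obtains r u where "r > 0" "continuous_on (ball (z j) r) u" "\<And>x. x \<in> ball (z j) r \<Longrightarrow> u x \<noteq> 0"
    "\<And>x. x \<in> ball (z j) r \<Longrightarrow> f x = (x - z j) * u x"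
proof -
  obtain M d h where h: "continuous_on (cball (z j) 1) h" "\<And>x. x \<in> cball (z j) 1 \<Longrightarrow> h x \<noteq> 0"
    and f: "\<And>x. x \<in> cball (z j) 1 \<Longrightarrow>
       f x = h x * x ^ (if 0 \<in> range z then 1 else 0) * (\<Prod>k<M. weierstrass_term z d k x)"
    and tail: "\<And>x k. x \<in> cball (z j) 1 \<Longrightarrow> k \<ge> M \<Longrightarrow> weierstrass_term z d k x \<noteq> 0"
    by (rule weierstrass_map_on_compact[OF f compact_cball[of "z j" 1]]) (rule that)
  \<comment> \<open>The sign and the division come from
    \<open>1 - x / z j = - (x - z j) / z j\<close>.\<close>
  define e where "e x = - exp (\<Sum>s=1..d j. (x / z j) ^ s / of_nat s) / z j" for x
  define u where "u x = h x * x ^ (if 0 \<in> range z then 1 else 0) *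
    (\<Prod>k\<in>{..<M} - {j}. weierstrass_term z d k x) * e x" for x
  have e: "weierstrass_term z d j x = (x - z j) * e x" for x
    using z(2) by (simp add: weierstrass_term_def weierstrass_factor_def e_def divide_simps)
      (simp add: algebra_simps)
  have j: "j \<in> {..<M}"
    using tail[of "z j" j] z(2) by (force simp: weierstrass_term_eq_0_iff)
  have fu: "f x = (x - z j) * u x" if "x \<in> cball (z j) 1" for x
  proof -
    have "(\<Prod>k<M. weierstrass_term z d k x) =
        weierstrass_term z d j x * (\<Prod>k\<in>{..<M} - {j}. weierstrass_term z d k x)"
      by (rule prod.remove) (use j in auto)
    thus ?thesis unfolding f[OF that] u_def e by (simp add: mult_ac)
  qed
  have "continuous_on (cball (z j) 1) u"
    unfolding u_def e_def
    by (intro continuous_intros h(1) continuous_on_weierstrass_term) (use z(2) in auto)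
  hence cu: "continuous_on (ball (z j) 1) u" by (rule continuous_on_subset) auto
  have "weierstrass_term z d k (z j) \<noteq> 0" if "k \<noteq> j" for k
    using that z(1) by (auto simp: weierstrass_term_eq_0_iff dest: injD)
  hence "(\<Prod>k\<in>{..<M} - {j}. weierstrass_term z d k (z j)) \<noteq> 0" by simp
  moreover have "h (z j) \<noteq> 0" by (rule h(2)) simp
  moreover have "e (z j) \<noteq> 0" using z(2) by (simp add: e_def)
  ultimately have u0: "u (z j) \<noteq> 0" using z(2) by (simp add: u_def)
  obtain \<epsilon> where \<epsilon>: "\<epsilon> > 0" "\<And>y. dist (z j) y < \<epsilon> \<Longrightarrow> u y \<noteq> 0"
    using continuous_on_open_avoid[OF cu open_ball _ u0] by auto
  show thesis
  proof (rule that[of "min \<epsilon> 1" u])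
    show "continuous_on (ball (z j) (min \<epsilon> 1)) u" by (rule continuous_on_subset[OF cu]) auto
  qed (use \<epsilon> fu in auto)
qed

section \<open>Comparison of the Veech groups\<close>

lemma developed_surface_superelliptic:
  assumes z: "inj z" "filterlim (\<lambda>k. norm (z k)) at_top sequentially"
    and f: "weierstrass_map z f" and n: "n > 0"
  shows "developed_surface (superelliptic_curve n z f) {(x, w). w ^ n = f x} fst (- range z)"
proof -
  let ?D = "- range z" and ?Y = "{(x, w). w ^ n = f x}" and ?\<Sigma> = "range (\<lambda>k. (z k, 0))"
  have D: "open ?D" using closed_range_if_tendsto_infinity[OF z(2)] by blast
  have con: "connected ?D"
    by (intro path_connected_imp_connected path_connected_complement_countable) auto
  have fc: "continuous_on ?D f" by (rule continuous_on_subset[OF continuous_weierstrass_map[OF f]]) simp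
  note f0 = weierstrass_map_eq_0_iff[OF f]
  have fD: "f x \<noteq> 0" if "x \<in> ?D" for x using f0[of x] that by blast
  \<comment> \<open>Over a puncture \<open>f\<close> vanishes and \<open>w = 0\<close> is the only
    solution, so deleting the cone points deletes whole fibres.\<close>
  have YS: "?Y - ?\<Sigma> = {(x, w). x \<in> ?D \<and> w ^ n = f x}"
  proof -
    have "(x, w) \<in> ?\<Sigma> \<longleftrightarrow> x \<in> range z" if "w ^ n = f x" for x w
    proof
      assume "x \<in> range z"
      hence "w = 0" using that f0[of x] n by simp
      thus "(x, w) \<in> ?\<Sigma>" using \<open>x \<in> range z\<close> by blast
    qed blast
    thus ?thesis by blast
  qed
  \<comment> \<open>Of two distinct punctures at least one is not the origin.\<close>
  have "z 0 \<noteq> z 1" using z(1) by (simp add: inj_eq)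
  then obtain j where j: "z j \<noteq> 0" by metis
  obtain r u where r: "r > 0" and u: "continuous_on (ball (z j) r) u" "\<And>x. x \<in> ball (z j) r \<Longrightarrow> u x \<noteq> 0"
    "\<And>x. x \<in> ball (z j) r \<Longrightarrow> f x = (x - z j) * u x"
    by (rule weierstrass_map_simple_zero[OF f z(1) j]) (rule that)
  have rD: "ball (z j) r - {z j} \<subseteq> ?D"
  proof
    fix x assume x: "x \<in> ball (z j) r - {z j}"
    hence "f x \<noteq> 0" using u(2)[of x] u(3)[of x] by simp
    thus "x \<in> ?D" using f0[of x] by blast
  qed
  show ?thesis
    unfolding superelliptic_curve_def
  proof (rule developed_surface_pullback[OF D])
    show "?\<Sigma> \<subseteq> ?Y" using f0 n by (auto simp: power_0_left)
    show "connected (?Y - ?\<Sigma>)"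
      unfolding YS by (rule connected_superelliptic[OF D con fc fD n r rD u])
    show "fst ` (?Y - ?\<Sigma>) = ?D"
    proof (intro equalityI subsetI)
      fix x assume x: "x \<in> ?D"
      obtain e g where "e > 0" "ball x e \<subseteq> ?D" "continuous_on (ball x e) g"
        and g: "\<And>y. y \<in> ball x e \<Longrightarrow> g y ^ n = f y" "\<And>y. y \<in> ball x e \<Longrightarrow> g y \<noteq> 0"
        by (rule local_root[OF D fc fD n x]) (assumption, rule that)
      hence "(x, g x) \<in> ?Y - ?\<Sigma>" using x unfolding YS by simp
      thus "x \<in> fst ` (?Y - ?\<Sigma>)" by force
    qed (use YS in auto)
    fix p assume "p \<in> ?Y - ?\<Sigma>"
    then obtain x w where p: "p = (x, w)" "x \<in> ?D" "w ^ n = f x" unfolding YS by blast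
    obtain U V s where U: "openin (top_of_set ?Y) U" "p \<in> U" "U \<subseteq> ?D \<times> UNIV" "open V" "V \<subseteq> ?D" "homeomorphism U V fst s"
      using superelliptic_chart[OF D fc fD n refl p(2,3)] unfolding p(1) by auto
    have "U \<inter> ?\<Sigma> = {}" using U(3) by blast
    thus "\<exists>U V s. openin (top_of_set ?Y) U \<and> p \<in> U \<and> U \<inter> ?\<Sigma> = {} \<and> open V \<and> V \<subseteq> ?D \<and> homeomorphism U V fst s"
      using U by blast
  qed
qed

lemma developed_surface_lifted:
  fixes C :: "'a::topological_space set"
  assumes z: "filterlim (\<lambda>k. norm (z k)) at_top sequentially"
    and cov: "covering_space C p (- range z)" and C: "connected C"
  shows "developed_surface (lifted_surface C p z) C p (- range z)"
proof -
  have D: "open (- range z)" using closed_range_if_tendsto_infinity[OF z] by blast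
  show ?thesis
    unfolding lifted_surface_def
  proof (rule developed_surface_pullback[OF D])
    show "connected (C - {})" "p ` (C - {}) = - range z"
      using C covering_space_imp_surjective[OF cov] by simp_all
    fix x assume "x \<in> C - {}"
    hence x: "x \<in> C" by simp
    obtain U V q where U: "x \<in> U" "openin (top_of_set C) U" "openin (top_of_set (- range z)) V" "homeomorphism U V p q"
      using covering_space_local_homeomorphism[OF cov x] by metis
    moreover have "open V" "V \<subseteq> - range z" using U(3) D by (simp_all add: openin_open_eq)
    ultimately show "\<exists>U V r. openin (top_of_set C) U \<and> x \<in> U \<and> U \<inter> {} = {} \<and> open V \<and> V \<subseteq> - range z \<and> homeomorphism U V p r"
      by blast
  qed simp
qed

lemma carrier_veech_group_lifted:
  fixes C :: "'a::topological_space set"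
  assumes z: "filterlim (\<lambda>k. norm (z k)) at_top sequentially"
    and cov: "covering_space C p (- range z)" and C: "simply_connected C"
  shows "carrier (veech_group (lifted_surface C p z)) =
    {A. det A > 0 \<and> (\<exists>t. (\<lambda>x. mat_act A x + t) ` (- range z) = - range z)}"
proof -
  let ?D = "- range z"
  have con: "connected C"
    by (rule path_connected_imp_connected[OF simply_connected_imp_path_connected_general[OF C]])
  interpret developed_surface "lifted_surface C p z" C p "- range z"
    by (rule developed_surface_lifted[OF z cov con])
  have op: "open ?D" using closed_range_if_tendsto_infinity[OF z] by blast
  have surf: "space_of (lifted_surface C p z) = top_of_set C" "cone_points (lifted_surface C p z) = {}"
    by (simp_all add: lifted_surface_def pullback_surface_def)
  have "A \<in> carrier (veech_group (lifted_surface C p z))"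
    if A: "det A > 0" "(\<lambda>x. mat_act A x + t) ` ?D = ?D" for A t
  proof -
    obtain B where B: "\<And>x. mat_act B (mat_act A x) = x" "\<And>x. mat_act A (mat_act B x) = x"
      using affine_bij[OF A(1)] by blast
    let ?g = "\<lambda>x. mat_act A x + t" and ?h = "\<lambda>y. mat_act B (y - t)"
    have "?h ` ?g ` ?D = ?D" by (simp add: image_image B)
    hence "?h ` ?D = ?D" unfolding A(2) .
    hence gh: "homeomorphism ?D ?D ?g ?h"
      unfolding homeomorphism_def using A(2) by (auto intro!: continuous_intros simp: B)
    have "C \<noteq> {}" using regular_nonempty regular_eq by blast
    \<comment> \<open>The equation for \<open>p (T x)\<close> is already global affineness in terms
      of the developing map \<open>p\<close>, so nothing has to be checked in charts.\<close>
    then obtain T T' where T: "homeomorphism C C T T'" "\<And>x. x \<in> C \<Longrightarrow> p (T x) = ?g (p x)"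
      by (rule homeomorphism_lift_to_universal_cover[OF cov C _ open_imp_locally_path_connected[OF op] gh])
        (rule that)
    have "homeomorphic_maps (top_of_set C) (top_of_set C) T T'"
      using T(1) unfolding homeomorphism_def homeomorphic_maps_def by auto
    hence hT: "homeomorphic_map (top_of_set C) (top_of_set C) T" using homeomorphic_map_maps by blast
    show ?thesis
    proof (rule veech_groupI[OF _ _ _ A(1)])
      show "restrict T C \<in> extensional C" by simp
      show "homeomorphic_map (space_of (lifted_surface C p z)) (space_of (lifted_surface C p z)) (restrict T C)"
        unfolding surf by (rule homeomorphic_map_eq[OF hT]) simp
      show "restrict T C ` cone_points (lifted_surface C p z) = cone_points (lifted_surface C p z)"
        by (simp add: surf)
      show "affine_wrt (restrict T C) A t" using T(2) regular_eq surf by simp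
    qed
  qed
  thus ?thesis using veech_group_image by blast
qed

theorem theorem2p7:
  fixes z :: "nat \<Rightarrow> complex"
    and f :: "complex \<Rightarrow> complex"
    and n :: nat
    and St :: "'a::topological_space set"
    and p :: "'a \<Rightarrow> complex"
  assumes "inj z"
    and "filterlim (\<lambda>k. norm (z k)) at_top sequentially"
    and "weierstrass_map z f"
    and "n \<ge> 2"
    and "covering_space St p (- range z)"
    and "simply_connected St"
  shows "subgroup (carrier (veech_group (superelliptic_curve n z f)))
           (veech_group (lifted_surface St p z))
       \<and> veech_group (punctured_plane z) = veech_group (lifted_surface St p z)"
proof
  have "n > 0" using assms(4) by simp
  note curve = developed_surface_superelliptic[OF assms(1,2,3) this]
  note lifted = carrier_veech_group_lifted[OF assms(2,5,6)]
  show "subgroup (carrier (veech_group (superelliptic_curve n z f))) (veech_group (lifted_surface St p z))"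
    by (rule veech_group_subgroup[OF curve])
      (use developed_surface.veech_group_image[OF curve] lifted in blast)
  have "carrier (veech_group (punctured_plane z)) = carrier (veech_group (lifted_surface St p z))"
    using carrier_veech_group_punctured_plane[OF assms(2)] lifted by simp
  \<comment> \<open>Both groups are \<open>GL2_plus\<close> with the carrier replaced, so equal
    carriers give equal structures.\<close>
  thus "veech_group (punctured_plane z) = veech_group (lifted_surface St p z)"
    by (simp add: veech_group_def)
qed

end
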